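(* Let $t(x)=\sqrt{(1-2q)^2x^2-2x(1+2q)+1}$. With $D,D_1,D_2,D_3,E$ as defined below, $D=D_1+D_2+D_3$ where $$D_1(x,v,w)=\frac{4vx^3\bigl(1+q+q(1-q)vx\bigr)}{b_1+b_2\,t(vx)},$$ $$b_1=(2q+1)(q+1)wx^2-2(w+1)qx-2x+2-\bigl((6q^3-q^2-4q+1)wx^2-(6q^2-3q-1)wx+(2-6q^2)x+6q\bigr)vx+(2q-1)(q-1)(qx-1)((2q-1)wx-2)v^2x^2,$$ $$b_2=(2q-1)(q+1)wx^2-2(w+1)qx-2x+2-(q-1)(qx-1)((2q-1)wx-2)vx,$$ $$D_2(x,v,w)=\frac{4vx^2}{2-(4qv+2qw-2v+w)x+vw(2q-1)^2x^2+(2+wx-2qwx)\,t(vx)},$$ $$D_3(x,v,w)=\frac{8vx}{6-w-2v(2qw+2q-1)x+v^2w(2q-1)^2x^2+(w+2-(2q-1)vwx)\,t(vx)}.$$ Moreover, $$E(x,v)=\frac{1-x-2qvx+2qx-t(x)}{2q(qv^2x-2qvx+vx-v+2)}.$$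
   Context: $\mathcal{S}_n(1342,1423)$ is the set of permutations of $[n]$ avoiding $1342$ and $1423$; $\mathrm{desc}$ counts descents. For $i,m\in[n]$, $\mathcal{D}_n(i,m)$ is the set of members with first letter $i$ in which $n,n-1,\ldots,n-m+1$ appear in decreasing order, $\mathcal{D}_n(m)=\bigcup_i\mathcal{D}_n(i,m)$, $d_n(i,m)=\sum_{\pi\in\mathcal{D}_n(i,m)}q^{\mathrm{desc}(\pi)}$. $\mathcal{E}_n(m)$ is the set of $\sigma\in\mathcal{D}_n(m)$ not expressible as $\sigma=\sigma'\sigma''$ with $\sigma'$ containing all of $[n-m+1,n]$ and $\sigma''$ a permutation of $[a]$, $a\ge1$; $e_n(m)=\sum_{\sigma\in\mathcal{E}_n(m)}q^{\mathrm{desc}(\sigma)}$. Generating functions: $D(x,v,w)=\sum_{n\ge1}\sum_{m=1}^n\sum_{i=1}^n d_n(i,m)v^iw^{m-1}x^n$, $E(x,v)=\sum_{n\ge1}\sum_{m=1}^n e_n(m)v^{m-1}x^n$, $D_1(x,v,w)=\sum_{n\ge3}\sum_{m=1}^{n-2}\sum_{i=1}^{n-m-1}d_n(i,m)v^iw^{m-1}x^n$, $D_2(x,v,w)=\sum_{n\ge2}\sum_{m=1}^{n-1}d_n(n-m,m)v^{n-m}w^{m-1}x^n$, $D_3(x,v,w)=\sum_{n\ge1}\sum_{m=1}^n d_n(n,m)v^nw^{m-1}x^n$. Square roots are the formal power series with constant term $1$. *)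

theory Defs
  imports
    "HOL-Computational_Algebra.Computational_Algebra"
    "HOL-Combinatorics.Multiset_Permutations"
    "HOL-Library.Sublist"
begin

section \<open>Pattern avoidance and descents\<close>

text \<open>Permutations of \<open>[n]\<close> are written in one-line notation, as lists in
  \<^term>\<open>permutations_of_set {1..n}\<close>.\<close>

definition order_iso :: "nat list \<Rightarrow> nat list \<Rightarrow> bool" where
  "order_iso \<rho> \<tau> \<longleftrightarrow> length \<rho> = length \<tau> \<and>
     (\<forall>i<length \<tau>. \<forall>j<length \<tau>. \<rho> ! i < \<rho> ! j \<longleftrightarrow> \<tau> ! i < \<tau> ! j)"

definition avoids :: "nat list \<Rightarrow> nat list \<Rightarrow> bool" where
  "avoids \<pi> \<tau> \<longleftrightarrow> \<not> (\<exists>\<rho>. subseq \<rho> \<pi> \<and> order_iso \<rho> \<tau>)"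

definition avoiders :: "nat \<Rightarrow> nat list set" where
  "avoiders n = {\<pi> \<in> permutations_of_set {1..n}. avoids \<pi> [1,3,4,2] \<and> avoids \<pi> [1,4,2,3]}"

definition desc :: "nat list \<Rightarrow> nat" where
  "desc \<pi> = card {i. Suc i < length \<pi> \<and> \<pi> ! i > \<pi> ! Suc i}"


section \<open>The two refinements\<close>

text \<open>For \<open>1 \<le> m \<le> n\<close> the list \<^term>\<open>rev [n - m + 1..<n + 1]\<close> is
  \<open>n, n - 1, \<dots>, n - m + 1\<close>.\<close>

definition D_set :: "nat \<Rightarrow> nat \<Rightarrow> nat \<Rightarrow> nat list set" where
  "D_set n i m = {\<pi> \<in> avoiders n. i \<in> {1..n} \<and> m \<in> {1..n} \<and> hd \<pi> = i \<and>
     subseq (rev [n - m + 1..<n + 1]) \<pi>}"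

definition D_all :: "nat \<Rightarrow> nat \<Rightarrow> nat list set" where
  "D_all n m = (\<Union>i\<in>{1..n}. D_set n i m)"

definition E_set :: "nat \<Rightarrow> nat \<Rightarrow> nat list set" where
  "E_set n m = {\<sigma> \<in> D_all n m.
     \<not> (\<exists>\<sigma>' \<sigma>'' a. a \<ge> 1 \<and> \<sigma> = \<sigma>' @ \<sigma>'' \<and> {n - m + 1..n} \<subseteq> set \<sigma>' \<and>
          \<sigma>'' \<in> permutations_of_set {1..a})}"


section \<open>The generating functions\<close>

text \<open>All identities are read as identities of formal power series in \<open>x\<close> over the field
  \<open>\<rat>(q,v,w)\<close> of rational functions in the indeterminates \<open>q\<close>, \<open>v\<close>, \<open>w\<close>. Passing to the
  fraction field gives the quotients their meaning: in the formula for \<open>E\<close> the denominator has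
  constant term \<open>2q(2 - v)\<close>, which is invertible in \<open>\<rat>(q,v,w)\<close> but not in \<open>\<rat>[[q,v,w]]\<close>.
  The innermost polynomial variable is \<open>q\<close>, the outermost one is \<open>w\<close>.\<close>

type_synonym ratfun = "rat poly poly poly fract"

definition indet_q :: ratfun where "indet_q = to_fract [:[:[:0, 1:]:]:]"
definition indet_v :: ratfun where "indet_v = to_fract [:[:0, 1:]:]"
definition indet_w :: ratfun where "indet_w = to_fract [:0, 1:]"

definition d :: "nat \<Rightarrow> nat \<Rightarrow> nat \<Rightarrow> ratfun" where
  "d n i m = (\<Sum>\<pi>\<in>D_set n i m. indet_q ^ desc \<pi>)"

definition e :: "nat \<Rightarrow> nat \<Rightarrow> ratfun" where
  "e n m = (\<Sum>\<sigma>\<in>E_set n m. indet_q ^ desc \<sigma>)"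

text \<open>In each series the lower bound on \<open>n\<close> is automatic: below it the range of \<open>m\<close> is empty,
  also with truncated subtraction.\<close>

definition D_gf :: "ratfun fps" where
  "D_gf = Abs_fps (\<lambda>n. \<Sum>m=1..n. \<Sum>i=1..n. d n i m * indet_v ^ i * indet_w ^ (m - 1))"

definition E_gf :: "ratfun fps" where
  "E_gf = Abs_fps (\<lambda>n. \<Sum>m=1..n. e n m * indet_v ^ (m - 1))"

definition D1_gf :: "ratfun fps" where
  "D1_gf = Abs_fps (\<lambda>n. \<Sum>m=1..n-2. \<Sum>i=1..n-m-1. d n i m * indet_v ^ i * indet_w ^ (m - 1))"

definition D2_gf :: "ratfun fps" where
  "D2_gf = Abs_fps (\<lambda>n. \<Sum>m=1..n-1. d n (n - m) m * indet_v ^ (n - m) * indet_w ^ (m - 1))"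

definition D3_gf :: "ratfun fps" where
  "D3_gf = Abs_fps (\<lambda>n. \<Sum>m=1..n. d n n m * indet_v ^ n * indet_w ^ (m - 1))"


section \<open>Square roots\<close>

definition fps_sqrt :: "'a::field_char_0 fps \<Rightarrow> 'a fps" where
  "fps_sqrt f = (THE s. s ^ 2 = f \<and> fps_nth s 0 = 1)"

lemma fps_sqrt_ex1:
  fixes f :: "'a::field_char_0 fps"
  assumes "fps_nth f 0 = 1"
  shows "\<exists>!s. s ^ 2 = f \<and> fps_nth s 0 = 1"
proof -
  let ?s = "fps_radical (\<lambda>_ _. 1) (Suc 1) f"
  have "s ^ Suc 1 = f \<longleftrightarrow> s = ?s" if "fps_nth s 0 = 1" for s
    using radical_unique[of "\<lambda>_ _. 1" 1 f s] assms that by simp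
  moreover have "fps_nth ?s 0 = 1"
    by simp
  ultimately show ?thesis
    by (metis Suc_1)
qed

lemma fps_sqrt:
  assumes "fps_nth f 0 = 1"
  shows "fps_sqrt f ^ 2 = f" and "fps_nth (fps_sqrt f) 0 = 1"
  using theI'[OF fps_sqrt_ex1[OF assms]] unfolding fps_sqrt_def by auto

end

theory Submission
  imports Defs
begin

text \<open>A permutation avoids 1342 and 1423 iff, for each of its letters, the larger letters to its
  right form a layered word, i.e. an increasing sequence of decreasing runs of which each lies
  entirely above the previous one. Fix the subword \<open>\<tau>\<close> formed by the letters above \<open>b\<close>. Deleting the
  first letter and inserting \<open>b\<close> into \<open>\<tau>\<close> (as a new first layer or at the end of the first layer)
  shows by induction that the \<open>q\<close>-count of the words with a given layered \<open>\<tau>\<close> depends only on \<open>b\<close>,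
  the length of \<open>\<tau>\<close> and its number of layers, and that splitting off one more layer turns a count
  \<open>F k\<close> into \<open>F k + (1 - q) F (k - 1)\<close>. This yields
  \<open>d n i m = 2 d n i (m + 1) + (1 - q) d (n - 1) i m\<close> for \<open>i + m < n\<close>, while the cases
  \<open>i = n - m\<close> and \<open>i = n\<close> reduce to \<open>n - 1\<close> directly. The resulting functional equations are
  solved by the kernel method, all of \<open>y\<close>, \<open>t\<close> and the total count being rational in a
  series \<open>s\<close> with \<open>t = 1 - y + 2qy - 4qs\<close>, where
  \<open>y = vx\<close> (\<open>y = x\<close> for \<open>E\<close>); splitting off the longest final permutation of \<open>[a]\<close> gives \<open>E\<close>.\<close>

section \<open>Layered words\<close>

text \<open>Avoidance of 231 and 312, the patterns left when the leading 1 is removed from 1342 and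
  1423.\<close>

definition layered :: "nat list \<Rightarrow> bool" where
  "layered \<tau> \<longleftrightarrow> (\<nexists>x y z. subseq [x, y, z] \<tau> \<and> (z < x \<and> x < y \<or> y < z \<and> z < x))"

definition good :: "nat list \<Rightarrow> bool" where
  "good \<pi> \<longleftrightarrow> (\<nexists>a x y z. subseq [a, x, y, z] \<pi> \<and> (a < z \<and> z < x \<and> x < y \<or> a < y \<and> y < z \<and> z < x))"

text \<open>In a nonempty layered word of distinct letters the ascents occur exactly between
  consecutive layers, so \<open>asc \<tau> + 1\<close> is the number of layers.\<close>

fun asc :: "nat list \<Rightarrow> nat" where
  "asc (x # y # \<tau>) = of_bool (x < y) + asc (y # \<tau>)"
| "asc _ = 0"

section \<open>Patterns as inequalities between letters\<close>

lemma order_iso_1342: "order_iso \<rho> [1,3,4,2] \<longleftrightarrow> (\<exists>a x y z. \<rho> = [a,x,y,z] \<and> a < z \<and> z < x \<and> x < y)"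
proof
  assume *: "order_iso \<rho> [1,3,4,2]"
  then have "length \<rho> = 4" by (simp add: order_iso_def)
  then obtain a x y z where r: "\<rho> = [a,x,y,z]"
    by (auto simp: numeral_eq_Suc length_Suc_conv)
  show "\<exists>a x y z. \<rho> = [a,x,y,z] \<and> a < z \<and> z < x \<and> x < y"
    using * unfolding r order_iso_def by (simp add: All_less_Suc)
next
  assume "\<exists>a x y z. \<rho> = [a,x,y,z] \<and> a < z \<and> z < x \<and> x < y"
  then show "order_iso \<rho> [1,3,4,2]"
    by (auto simp: order_iso_def All_less_Suc)
qed

lemma order_iso_1423: "order_iso \<rho> [1,4,2,3] \<longleftrightarrow> (\<exists>a x y z. \<rho> = [a,x,y,z] \<and> a < y \<and> y < z \<and> z < x)"
proof
  assume *: "order_iso \<rho> [1,4,2,3]"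
  then have "length \<rho> = 4" by (simp add: order_iso_def)
  then obtain a x y z where r: "\<rho> = [a,x,y,z]"
    by (auto simp: numeral_eq_Suc length_Suc_conv)
  show "\<exists>a x y z. \<rho> = [a,x,y,z] \<and> a < y \<and> y < z \<and> z < x"
    using * unfolding r order_iso_def by (simp add: All_less_Suc)
next
  assume "\<exists>a x y z. \<rho> = [a,x,y,z] \<and> a < y \<and> y < z \<and> z < x"
  then show "order_iso \<rho> [1,4,2,3]"
    by (auto simp: order_iso_def All_less_Suc)
qed

lemma avoids_iff_good: "avoids \<pi> [1,3,4,2] \<and> avoids \<pi> [1,4,2,3] \<longleftrightarrow> good \<pi>"
  unfolding avoids_def good_def order_iso_1342 order_iso_1423 by blast

lemma subseq_set: "subseq xs ys \<Longrightarrow> set xs \<subseteq> set ys"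
  by (induction rule: list_emb.induct) auto

lemma subseq_distinct: "subseq xs ys \<Longrightarrow> distinct ys \<Longrightarrow> distinct xs"
  by (induction rule: list_emb.induct) (auto dest: subseq_set)

lemma good_subseq: "good \<pi> \<Longrightarrow> subseq \<rho> \<pi> \<Longrightarrow> good \<rho>"
  unfolding good_def by (meson subseq_order.trans)

lemma layered_subseq: "layered \<pi> \<Longrightarrow> subseq \<rho> \<pi> \<Longrightarrow> layered \<rho>"
  unfolding layered_def by (meson subseq_order.trans)

lemma layeredD: "layered \<tau> \<Longrightarrow> subseq [x, y, z] \<tau> \<Longrightarrow> \<not> (z < x \<and> x < y) \<and> \<not> (y < z \<and> z < x)"
  unfolding layered_def by blast

lemma layered_filter: "layered \<pi> \<Longrightarrow> layered (filter P \<pi>)"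
  by (erule layered_subseq) (rule subseq_filter_left)

lemma subseq_filter_iff: "subseq xs (filter P ys) \<longleftrightarrow> subseq xs ys \<and> (\<forall>x\<in>set xs. P x)"
proof
  assume *: "subseq xs (filter P ys)"
  have "subseq xs ys" using * subseq_filter_left by (rule subseq_order.trans)
  moreover from * have "set xs \<subseteq> set (filter P ys)"
    by (rule subseq_set) 
  ultimately show "subseq xs ys \<and> (\<forall>x\<in>set xs. P x)" by auto
next
  assume "subseq xs ys \<and> (\<forall>x\<in>set xs. P x)"
  then show "subseq xs (filter P ys)"
    using subseq_filter[of xs ys P] by (simp add: filter_id_conv)
qed

lemma subseq_Cons_right: "subseq (a # xs) (b # ys) \<longleftrightarrow> subseq (a # xs) ys \<or> a = b \<and> subseq xs ys"
  by (metis subseq_Cons' subseq_Cons2_iff)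

text \<open>Brings sortedness into the same form as pattern containment, so that decreasing runs can
  be read off from forbidden subsequences.\<close>

lemma sorted_wrt_iff_subseq: "sorted_wrt P xs \<longleftrightarrow> (\<forall>x y. subseq [x, y] xs \<longrightarrow> P x y)"
proof (induction xs)
  case (Cons a xs)
  have "subseq [x, y] (a # xs) \<longleftrightarrow> subseq [x, y] xs \<or> x = a \<and> y \<in> set xs" for x y
    unfolding subseq_Cons_right by (simp add: subseq_singleton_left)
  then show ?case using Cons by auto
qed simp

lemma good_Nil [simp]: "good []"
  by (simp add: good_def)

text \<open>A forbidden pattern lies in \<open>\<pi>\<close> or begins with \<open>a\<close>; in the
  second case \<open>a\<close> is its smallest letter, and the other three letters form 231 or 312
  among the letters above \<open>a\<close>.\<close>

lemma good_Cons: "good (a # \<pi>) \<longleftrightarrow> layered (filter (\<lambda>x. a < x) \<pi>) \<and> good \<pi>"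
proof -
  have sub: "subseq [b, x, y, z] (a # \<pi>) \<longleftrightarrow> subseq [b, x, y, z] \<pi> \<or> b = a \<and> subseq [x, y, z] \<pi>"
    for b x y z by (rule subseq_Cons_right)
  have fil: "subseq [x, y, z] (filter (\<lambda>x. a < x) \<pi>) \<longleftrightarrow> subseq [x, y, z] \<pi> \<and> a < x \<and> a < y \<and> a < z"
    for x y z by (simp add: subseq_filter_iff)
  have eq: "(a < x \<and> a < y \<and> a < z) \<and> (z < x \<and> x < y \<or> y < z \<and> z < x) \<longleftrightarrow>
      a < z \<and> z < x \<and> x < y \<or> a < y \<and> y < z \<and> z < x" for x y z by linarith
  show ?thesis
    unfolding good_def layered_def sub fil using eq by blast
qed

section \<open>Inserting a new minimum into a layered word\<close>

lemma sublist_order_cases: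
  assumes "subseq [x, y, z] (xs @ c # ys)"
  shows "subseq [x, y, z] (xs @ ys) \<or> x = c \<and> subseq [y, z] ys
    \<or> y = c \<and> x \<in> set xs \<and> z \<in> set ys \<or> z = c \<and> subseq [x, y] xs"
  using assms
proof (induction xs)
  case Nil
  then show ?case by (auto split: if_splits)
next
  case (Cons a xs)
  have two: "subseq [y, z] (xs @ ys) \<or> y = c \<and> z \<in> set ys \<or> z = c \<and> y \<in> set xs"
    if "subseq [y, z] (xs @ c # ys)"
    using that by (induction xs) (auto simp: subseq_singleton_left split: if_splits)
  have "subseq [x, y, z] (xs @ c # ys) \<or> x = a \<and> subseq [y, z] (xs @ c # ys)"
    using Cons.prems by (simp add: subseq_Cons_right del: subseq_Cons2_iff)
  then show ?case
  proof (elim disjE conjE)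
    assume "subseq [x, y, z] (xs @ c # ys)"
    from Cons.IH[OF this] show ?thesis by (auto simp del: subseq_Cons2_iff)
  next
    assume "x = a" "subseq [y, z] (xs @ c # ys)"
    with two[OF this(2)] show ?thesis by (auto simp: subseq_singleton_left)
  qed
qed

text \<open>A minimum can only play the 1 of 231 or of 312. As the last letter of 231 it forbids
  ascents in \<open>xs\<close>; as the middle letter of 312 it forbids a letter of \<open>xs\<close>
  above one of \<open>ys\<close>.\<close>

lemma layered_insert_min_iff:
  assumes "\<forall>x\<in>set (xs @ ys). c < x" "distinct (xs @ ys)"
  shows "layered (xs @ c # ys) \<longleftrightarrow>
    layered (xs @ ys) \<and> sorted_wrt (>) xs \<and> (\<forall>x\<in>set xs. \<forall>y\<in>set ys. x < y)"
proof (intro iffI conjI)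
  assume add_layers: "layered (xs @ c # ys)"
  show "layered (xs @ ys)"
    using add_layers by (rule layered_subseq) (auto intro: list_emb_append_mono)
  show "\<forall>x\<in>set xs. \<forall>y\<in>set ys. x < y"
  proof (intro ballI, rule ccontr)
    fix x y assume *: "x \<in> set xs" "y \<in> set ys" "\<not> x < y"
    have "subseq ([x] @ [c,y]) (xs @ c # ys)"
      using * by (intro list_emb_append_mono) (auto simp: subseq_singleton_left)
    moreover have "c < y" "y < x" using * assms by (auto simp: not_less le_less)
    ultimately show False using layeredD[OF add_layers, of x c y] by simp
  qed
  have "x > y" if "subseq [x,y] xs" for x y
  proof (rule ccontr)
    assume "\<not> x > y"
    have "subseq ([x,y] @ [c]) (xs @ c # ys)"
      using that by (intro list_emb_append_mono) auto
    moreover have "set [x,y] \<subseteq> set xs" using that by (rule subseq_set)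
    moreover have "distinct [x,y]" using that assms(2) by (metis distinct_append subseq_distinct)
    ultimately show False using layeredD[OF add_layers, of x y c] \<open>\<not> x > y\<close> assms(1) by auto
  qed
  then show "sorted_wrt (>) xs"
    by (simp add: sorted_wrt_iff_subseq)
next
  assume *: "layered (xs @ ys) \<and> sorted_wrt (>) xs \<and> (\<forall>x\<in>set xs. \<forall>y\<in>set ys. x < y)"
  have s: "x > y" if "subseq [x,y] xs" for x y
    using * that by (simp add: sorted_wrt_iff_subseq)
  show "layered (xs @ c # ys)"
    unfolding layered_def
  proof clarify
    fix x y z assume ss: "subseq [x,y,z] (xs @ c # ys)" and o: "z < x \<and> x < y \<or> y < z \<and> z < x"
    from sublist_order_cases[OF ss] show False
    proof (elim disjE conjE)
      assume "subseq [x,y,z] (xs @ ys)" then show False using layeredD * o by blast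
    next
      assume "x = c" "subseq [y, z] ys"
      moreover from this have "c < z" using assms(1) by (auto dest: subseq_set)
      ultimately show False using o by simp
    next
      assume "y = c" "x \<in> set xs" "z \<in> set ys"
      then show False using o * assms by fastforce
    next
      assume "z = c" "subseq [x, y] xs"
      moreover from this have "c < y" using assms(1) by (auto dest: subseq_set)
      ultimately show False using o s[of x y] by simp
    qed
  qed
qed

text \<open>Induction from the left: a new first letter \<open>a\<close> either is a layer below
  everything else or becomes the top of the first layer, depending on its comparison with the old
  first letter \<open>h\<close>.\<close>

lemma layered_first_run:
  assumes "layered \<tau>" "distinct \<tau>" "\<tau> \<noteq> []"
  shows "\<exists>xs ys. \<tau> = xs @ ys \<and> xs \<noteq> [] \<and> sorted_wrt (>) xs \<and> (\<forall>x\<in>set xs. \<forall>y\<in>set ys. x < y)"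
  using assms
proof (induction \<tau>)
  case (Cons a \<tau>)
  show ?case
  proof (cases "\<tau> = []")
    case True
    then show ?thesis by (intro exI[of _ "[a]"] exI[of _ "[]"]) auto
  next
    case False
    have "layered \<tau>" using Cons.prems(1) by (rule layered_subseq) auto
    then obtain xs ys where *: "\<tau> = xs @ ys" "xs \<noteq> []" "sorted_wrt (>) xs" "\<forall>x\<in>set xs. \<forall>y\<in>set ys. x < y"
      using Cons False by auto
    obtain h xs' where xs: "xs = h # xs'" using *(2) by (cases xs) auto
    \<comment> \<open>Since \<open>h\<close> directly follows \<open>a\<close>, it is available as
      the middle letter of a pattern \<open>[a, h, z]\<close>: 231 if \<open>a < h\<close>, and 312
      if \<open>h < a\<close>.\<close>
    have no: "\<not> (z < a \<and> a < h \<or> h < z \<and> z < a)" if "z \<in> set (xs' @ ys)" for z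
    proof -
      have "subseq [z] (xs' @ ys)" using that by (simp add: subseq_singleton_left)
      then have "subseq [a,h,z] (a # \<tau>)" by (simp add: *(1) xs)
      then show ?thesis using layeredD[OF Cons.prems(1)] by blast
    qed
    show ?thesis
    proof (cases "a < h")
      case True
      have "a < y" if "y \<in> set \<tau>" for y
      proof (rule ccontr)
        assume "\<not> a < y"
        moreover have "y \<noteq> a" using that Cons.prems(2) by auto
        ultimately have "y < a" by simp
        then show False using no[of y] that True by (auto simp: *(1) xs)
      qed
      then show ?thesis by (intro exI[of _ "[a]"] exI[of _ \<tau>]) auto
    next
      case False
      then have h: "h < a" using Cons.prems(2) by (auto simp: *(1) xs)
      have "a < y" if "y \<in> set ys" for y
      proof (rule ccontr)
        assume "\<not> a < y"
        moreover have "y \<noteq> a" using that Cons.prems(2) by (auto simp: *(1))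
        ultimately have "y < a" by simp
        moreover have "h < y" using *(4) that by (auto simp: xs)
        ultimately show False using no[of y] that by auto
      qed
      moreover have "\<forall>x\<in>set xs. a > x" using *(3) h by (auto simp: xs)
      ultimately show ?thesis using *
        by (intro exI[of _ "a # xs"] exI[of _ ys]) auto
    qed
  qed
qed simp

text \<open>If \<open>xs\<close> ended earlier than \<open>xs'\<close>, the next letter would belong
  to the decreasing word \<open>xs'\<close> and lie below the letters of \<open>xs\<close>, but it
  would also belong to \<open>ys\<close> and lie above them.\<close>

lemma first_run_unique:
  assumes "xs @ ys = xs' @ ys'" "xs \<noteq> []" "length xs \<le> length xs'"
    "\<forall>x\<in>set xs. \<forall>y\<in>set ys. x < y" "sorted_wrt (>) xs'"
  shows "xs = xs' \<and> ys = (ys' :: nat list)"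
proof -
  obtain us where us: "xs' = xs @ us" "ys = us @ ys'"
    using assms(1,3) by (auto simp: append_eq_append_conv2)
  have "us = []"
  proof (rule ccontr)
    assume "us \<noteq> []"
    then have "hd us \<in> set us" "hd xs \<in> set xs" using assms(2) by auto
    moreover have "\<forall>x\<in>set xs. \<forall>y\<in>set us. y < x"
      using assms(5) unfolding us by (simp add: sorted_wrt_append)
    moreover have "set us \<subseteq> set ys" by (simp add: us)
    ultimately show False using assms(4) by (meson less_asym subsetD)
  qed
  then show ?thesis using us by simp
qed

lemma asc_append:
  "xs \<noteq> [] \<Longrightarrow> ys \<noteq> [] \<Longrightarrow> asc (xs @ ys) = asc xs + of_bool (last xs < hd ys) + asc ys"
proof (induction xs)
  case (Cons a xs)
  then show ?case by (cases xs; cases ys) auto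
qed simp

lemma asc_sorted: "sorted_wrt (>) xs \<Longrightarrow> asc xs = 0"
  by (induction xs rule: asc.induct) auto

lemma asc_Cons_less: "\<tau> \<noteq> [] \<Longrightarrow> c < hd \<tau> \<Longrightarrow> asc (c # \<tau>) = Suc (asc \<tau>)"
  by (cases \<tau>) auto

lemma asc_Cons_greater: "\<tau> \<noteq> [] \<Longrightarrow> hd \<tau> \<le> c \<Longrightarrow> asc (c # \<tau>) = asc \<tau>"
  by (cases \<tau>) auto

lemma asc_less_length: "\<tau> \<noteq> [] \<Longrightarrow> asc \<tau> < length \<tau>"
  by (induction \<tau> rule: asc.induct) auto

text \<open>The part to the left of \<open>c\<close> must be empty or the whole first layer, so
  \<open>c\<close> is either a new layer in front or the last letter of the first layer. The second
  choice preserves the number of ascents.\<close>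

lemma layered_insert_min:
  assumes "layered \<tau>" "distinct \<tau>" "\<tau> \<noteq> []" "\<forall>x\<in>set \<tau>. c < x"
  obtains \<tau>' where "{\<rho>. layered \<rho> \<and> distinct \<rho> \<and> set \<rho> = insert c (set \<tau>) \<and> filter (\<lambda>x. c < x) \<rho> = \<tau>}
      = {c # \<tau>, \<tau>'}" "\<tau>' \<noteq> c # \<tau>" "asc \<tau>' = asc \<tau>" "length \<tau>' = Suc (length \<tau>)"
proof -
  obtain xs ys where *: "\<tau> = xs @ ys" "xs \<noteq> []" "sorted_wrt (>) xs" "\<forall>x\<in>set xs. \<forall>y\<in>set ys. x < y"
    using layered_first_run assms by blast
  let ?t = "xs @ c # ys"
  let ?S = "{\<rho>. layered \<rho> \<and> distinct \<rho> \<and> set \<rho> = insert c (set \<tau>) \<and> filter (\<lambda>x. c < x) \<rho> = \<tau>}"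
  have "\<rho> \<in> {c # \<tau>, ?t}" if \<rho>: "\<rho> \<in> ?S" for \<rho>
  proof -
    obtain us vs where uv: "\<rho> = us @ c # vs" using \<rho> split_list[of c \<rho>] by auto
    have "set us \<union> set vs \<subseteq> set \<tau>" using \<rho> uv by auto
    then have "\<forall>x\<in>set (us @ vs). c < x" using assms(4) by auto
    then have "filter (\<lambda>x. c < x) \<rho> = us @ vs" by (auto simp: uv filter_id_conv)
    then have t: "\<tau> = us @ vs" using \<rho> by auto
    have l: "sorted_wrt (>) us \<and> (\<forall>x\<in>set us. \<forall>y\<in>set vs. x < y)"
      using layered_insert_min_iff[of us vs c] \<rho> assms t uv by auto
    show ?thesis
    proof (cases "us = []")
      case False
      \<comment> \<open>It is open which of the two runs is shorter, so uniqueness is applied in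
        both directions.\<close>
      have "us = xs \<and> vs = ys"
        using first_run_unique[of us vs xs ys] first_run_unique[of xs ys us vs] * l False t
        by (metis nat_le_linear)
      then show ?thesis using uv by simp
    qed (use uv t in simp)
  qed
  moreover have "layered ?t" using layered_insert_min_iff[of xs ys c] assms * by auto
  moreover have "layered (c # \<tau>)" using layered_insert_min_iff[of "[]" \<tau> c] assms by auto
  moreover have "c \<notin> set \<tau>" "filter (\<lambda>x. c < x) \<tau> = \<tau>" using assms(4) by (auto simp: filter_id_conv)
  ultimately have "?S = {c # \<tau>, ?t}"
    using assms(2) by (auto simp: *(1))
  moreover have "?t \<noteq> c # \<tau>" using * assms(4) by (cases xs) auto
  moreover have "asc ?t = asc \<tau>"
  proof (cases "ys = []")
    case True
    have "c < last xs" using *(1,2) assms(4) by auto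
    then show ?thesis using *(1,2) True by (simp add: asc_append)
  next
    case False
    have "last xs \<in> set xs" "hd ys \<in> set ys" using * False by auto
    \<comment> \<open>The ascent from \<open>last xs\<close> to \<open>hd ys\<close> is replaced by
      the one from \<open>c\<close> to \<open>hd ys\<close>.\<close>
    then have "c < last xs" "c < hd ys" "last xs < hd ys" using * assms(4) by auto
    moreover from this have "asc (c # ys) = Suc (asc ys)" using False by (simp add: asc_Cons_less)
    ultimately show ?thesis using *(1,2) False by (simp add: asc_append)
  qed
  ultimately show thesis using that by (simp add: *(1))
qed


section \<open>Words with prescribed large letters\<close>

lemma desc_Cons: "desc (x # \<pi>) = of_bool (\<pi> \<noteq> [] \<and> hd \<pi> < x) + desc \<pi>"
proof (cases \<pi>)
  case Nil
  then show ?thesis by (simp add: desc_def)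
next
  case (Cons y \<rho>)
  let ?A = "{i. Suc i < length \<pi> \<and> \<pi> ! i > \<pi> ! Suc i}"
  \<comment> \<open>Index 0 accounts for the new first letter; the other descents move up by
    one.\<close>
  have "{i. Suc i < length (x # \<pi>) \<and> (x # \<pi>) ! i > (x # \<pi>) ! Suc i}
      = (if hd \<pi> < x then {0} else {}) \<union> Suc ` ?A" (is "?L = ?R")
  proof (rule set_eqI)
    fix i show "i \<in> ?L \<longleftrightarrow> i \<in> ?R"
      using Cons by (cases i) auto
  qed
  moreover have "finite ?A" by (rule finite_subset[of _ "{..<length \<pi>}"]) auto
  ultimately show ?thesis
    using Cons by (auto simp: desc_def card_insert_if card_image)
qed

text \<open>The large letters \<open>\<tau>\<close> are not standardized, so deleting the first letter of a word
  needs no relabelling.\<close>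

definition words :: "nat \<Rightarrow> nat list \<Rightarrow> nat list set" where
  "words b \<tau> = {\<pi>. distinct \<pi> \<and> set \<pi> = {1..b} \<union> set \<tau> \<and> good \<pi> \<and> filter (\<lambda>x. b < x) \<pi> = \<tau>}"

definition wt :: "nat list set \<Rightarrow> ratfun" where
  "wt A = (\<Sum>\<pi>\<in>A. indet_q ^ desc \<pi>)"

definition words_hd :: "nat \<Rightarrow> nat list \<Rightarrow> nat \<Rightarrow> nat list set" where
  "words_hd b \<tau> i = {\<pi> \<in> words b \<tau>. hd \<pi> = i}"

lemma finite_words [simp]: "finite (words b \<tau>)"
proof (rule finite_subset)
  show "words b \<tau> \<subseteq> {\<pi>. set \<pi> \<subseteq> {1..b} \<union> set \<tau> \<and> distinct \<pi>}"
    by (auto simp: words_def)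
  show "finite {\<pi>. set \<pi> \<subseteq> {1..b} \<union> set \<tau> \<and> distinct \<pi>}"
    by (rule finite_subset_distinct) simp
qed

lemma finite_words_hd [simp]: "finite (words_hd b \<tau> i)"
  by (simp add: words_hd_def)

lemma words_nonempty: "\<pi> \<in> words b \<tau> \<Longrightarrow> \<tau> \<noteq> [] \<Longrightarrow> \<pi> \<noteq> []"
  by (auto simp: words_def)

lemma words_empty: "words 0 [] = {[]}"
  by (auto simp: words_def)

section \<open>Splitting words by their first letter\<close>

lemma hd_words:
  assumes "\<pi> \<in> words b \<tau>" "\<tau> \<noteq> []"
  shows "hd \<pi> = hd \<tau> \<or> hd \<pi> \<in> {1..b}"
proof -
  have "\<pi> \<noteq> []" using words_nonempty assms by auto
  then show ?thesis
    using assms by (cases \<pi>) (auto simp: words_def split: if_splits)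
qed

text \<open>The letters above \<open>c\<close> to its right form a subword of \<open>\<tau>\<close>,
  hence a layered word, so putting \<open>c\<close> in front creates no pattern.\<close>

lemma words_hd_top:
  assumes "layered (c # \<tau>)" "distinct (c # \<tau>)" "\<forall>x\<in>set (c # \<tau>). b < x"
  shows "words_hd b (c # \<tau>) c = (#) c ` words b \<tau>"
proof (intro equalityI subsetI)
  fix \<pi> assume \<pi>: "\<pi> \<in> words_hd b (c # \<tau>) c"
  then have "\<pi> \<noteq> []" using words_nonempty by (auto simp: words_hd_def)
  then obtain \<rho> where \<rho>: "\<pi> = c # \<rho>" using \<pi> by (cases \<pi>) (auto simp: words_hd_def)
  have "set \<rho> = {1..b} \<union> set \<tau>"
  proof -
    have "insert c (set \<rho>) = insert c ({1..b} \<union> set \<tau>)" using \<pi> by (simp add: \<rho> words_hd_def words_def)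
    moreover have "c \<notin> set \<rho>" "c \<notin> {1..b} \<union> set \<tau>"
      using \<pi> assms by (auto simp: \<rho> words_hd_def words_def)
    ultimately show ?thesis by (metis insert_ident)
  qed
  then have "\<rho> \<in> words b \<tau>" using \<pi> assms by (auto simp: \<rho> words_hd_def words_def good_Cons)
  then show "\<pi> \<in> (#) c ` words b \<tau>" using \<rho> by simp
next
  fix \<pi> assume "\<pi> \<in> (#) c ` words b \<tau>"
  then obtain \<rho> where \<rho>: "\<pi> = c # \<rho>" "\<rho> \<in> words b \<tau>" by auto
  have "layered \<tau>" using assms(1) by (rule layered_subseq) auto
  then have "layered (filter (\<lambda>x. c < x) \<tau>)" by (rule layered_filter)
  also have "filter (\<lambda>x. c < x) \<tau> = filter (\<lambda>x. c < x) (filter (\<lambda>x. b < x) \<rho>)"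
    using \<rho>(2) by (simp add: words_def)
  also have "\<dots> = filter (\<lambda>x. c < x) \<rho>"
    using assms(3) by (auto simp: intro!: filter_cong)
  finally show "\<pi> \<in> words_hd b (c # \<tau>) c"
    using \<rho> assms by (auto simp: words_hd_def words_def good_Cons)
qed

text \<open>Once \<open>Suc b\<close> is removed, no remaining letter distinguishes the thresholds
  \<open>b\<close> and \<open>Suc b\<close>, so the large letters are \<open>\<tau>\<close>
  again.\<close>

lemma words_hd_bottom:
  assumes "layered \<tau>" "\<forall>x\<in>set \<tau>. Suc b < x"
  shows "words_hd (Suc b) \<tau> (Suc b) = (#) (Suc b) ` words b \<tau>"
proof (intro equalityI subsetI)
  fix \<pi> assume \<pi>: "\<pi> \<in> words_hd (Suc b) \<tau> (Suc b)"
  then have "\<pi> \<noteq> []" by (auto simp: words_hd_def words_def)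
  then obtain \<rho> where \<rho>: "\<pi> = Suc b # \<rho>" using \<pi> by (cases \<pi>) (auto simp: words_hd_def)
  have "set \<rho> = {1..b} \<union> set \<tau>"
  proof -
    have "insert (Suc b) (set \<rho>) = insert (Suc b) ({1..b} \<union> set \<tau>)"
      using \<pi> by (simp add: \<rho> words_hd_def words_def atLeastAtMostSuc_conv)
    moreover have "Suc b \<notin> set \<rho>" "Suc b \<notin> {1..b} \<union> set \<tau>"
      using \<pi> assms by (auto simp: \<rho> words_hd_def words_def)
    ultimately show ?thesis by (metis insert_ident)
  qed
  moreover have "filter (\<lambda>x. b < x) \<rho> = filter (\<lambda>x. Suc b < x) \<rho>"
  proof (rule filter_cong[OF refl])
    fix x assume "x \<in> set \<rho>"
    then have "x \<noteq> Suc b" using \<pi> by (auto simp: \<rho> words_hd_def words_def)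
    then show "b < x \<longleftrightarrow> Suc b < x" by linarith
  qed
  ultimately have "\<rho> \<in> words b \<tau>" using \<pi> assms by (auto simp: \<rho> words_hd_def words_def good_Cons)
  then show "\<pi> \<in> (#) (Suc b) ` words b \<tau>" using \<rho> by simp
next
  fix \<pi> assume "\<pi> \<in> (#) (Suc b) ` words b \<tau>"
  then obtain \<rho> where \<rho>: "\<pi> = Suc b # \<rho>" "\<rho> \<in> words b \<tau>" by auto
  have n: "Suc b \<notin> set \<rho>" using \<rho>(2) assms(2) by (auto simp: words_def)
  have "filter (\<lambda>x. b < x) \<rho> = filter (\<lambda>x. Suc b < x) \<rho>"
  proof (rule filter_cong[OF refl])
    fix x assume "x \<in> set \<rho>"
    then have "x \<noteq> Suc b" using n by auto
    then show "b < x \<longleftrightarrow> Suc b < x" by linarith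
  qed
  then have fl: "filter (\<lambda>x. Suc b < x) \<rho> = \<tau>" using \<rho> by (simp add: words_def)
  moreover have "good \<rho>" "distinct \<rho>" "set \<rho> = {1..b} \<union> set \<tau>" using \<rho> by (simp_all add: words_def)
  ultimately show "\<pi> \<in> words_hd (Suc b) \<tau> (Suc b)"
    unfolding words_hd_def words_def mem_Collect_eq \<rho>(1) good_Cons fl
    using assms(1) n fl by (simp add: atLeastAtMostSuc_conv)
qed

text \<open>A first letter \<open>i \<le> b\<close> forces the letters above \<open>b\<close> to be
  layered. Lowering the threshold from \<open>Suc b\<close> to \<open>b\<close> therefore sorts the
  words by the layered word that results from inserting \<open>Suc b\<close> into
  \<open>\<tau>\<close>.\<close>

lemma words_hd_step:
  assumes "layered \<tau>" "distinct \<tau>" "\<tau> \<noteq> []" "\<forall>x\<in>set \<tau>. Suc b < x" "1 \<le> i" "i \<le> b"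
    and S: "{\<rho>. layered \<rho> \<and> distinct \<rho> \<and> set \<rho> = insert (Suc b) (set \<tau>) \<and> filter (\<lambda>x. Suc b < x) \<rho> = \<tau>} = S"
  shows "words_hd (Suc b) \<tau> i = (\<Union>\<rho>\<in>S. words_hd b \<rho> i)"
proof (intro equalityI subsetI)
  fix \<pi> assume \<pi>: "\<pi> \<in> words_hd (Suc b) \<tau> i"
  let ?\<rho> = "filter (\<lambda>x. b < x) \<pi>"
  have "\<pi> \<noteq> []" using \<pi> words_nonempty assms(3) by (auto simp: words_hd_def)
  then obtain \<sigma> where \<sigma>: "\<pi> = i # \<sigma>" using \<pi> by (cases \<pi>) (auto simp: words_hd_def)
  have "layered (filter (\<lambda>x. i < x) \<sigma>)" using \<pi> by (simp add: \<sigma> words_hd_def words_def good_Cons)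
  then have "layered (filter (\<lambda>x. b < x) (filter (\<lambda>x. i < x) \<sigma>))" by (rule layered_filter)
  also have "filter (\<lambda>x. b < x) (filter (\<lambda>x. i < x) \<sigma>) = ?\<rho>"
    using assms(6) by (auto simp: \<sigma> intro!: filter_cong)
  finally have "layered ?\<rho>" .
  moreover have "filter (\<lambda>x. Suc b < x) ?\<rho> = filter (\<lambda>x. Suc b < x) \<pi>"
    by (auto intro!: filter_cong)
  moreover have setr: "set ?\<rho> = insert (Suc b) (set \<tau>)"
  proof -
    have "set \<pi> = {1..Suc b} \<union> set \<tau>" using \<pi> by (simp add: words_hd_def words_def)
    then show ?thesis using assms(4) by auto
  qed
  moreover have "distinct ?\<rho>" "filter (\<lambda>x. Suc b < x) \<pi> = \<tau>"
    using \<pi> by (simp_all add: words_hd_def words_def)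
  ultimately have "?\<rho> \<in> S"
    unfolding S[symmetric] by simp
  moreover have "{1..b} \<union> insert (Suc b) (set \<tau>) = {1..Suc b} \<union> set \<tau>" by auto
  then have "\<pi> \<in> words_hd b ?\<rho> i"
    using \<pi> unfolding words_hd_def words_def mem_Collect_eq setr by simp
  ultimately show "\<pi> \<in> (\<Union>\<rho>\<in>S. words_hd b \<rho> i)" by blast
next
  fix \<pi> assume "\<pi> \<in> (\<Union>\<rho>\<in>S. words_hd b \<rho> i)"
  then obtain \<rho> where \<rho>: "\<rho> \<in> S" "\<pi> \<in> words_hd b \<rho> i" by auto
  have set: "set \<rho> = insert (Suc b) (set \<tau>)" and fl: "filter (\<lambda>x. Suc b < x) \<rho> = \<tau>"
    using \<rho>(1) by (auto simp: S[symmetric])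
  have "filter (\<lambda>x. Suc b < x) \<pi> = filter (\<lambda>x. Suc b < x) (filter (\<lambda>x. b < x) \<pi>)"
    by (auto intro!: filter_cong)
  also have "\<dots> = \<tau>" using \<rho>(2) fl by (simp add: words_hd_def words_def)
  finally have "filter (\<lambda>x. Suc b < x) \<pi> = \<tau>" .
  moreover have "{1..b} \<union> insert (Suc b) (set \<tau>) = {1..Suc b} \<union> set \<tau>" by auto
  ultimately show "\<pi> \<in> words_hd (Suc b) \<tau> i"
    using \<rho>(2) unfolding words_hd_def words_def mem_Collect_eq set by simp
qed

lemma wt_words:
  assumes "\<tau> \<noteq> []" "\<forall>x\<in>set \<tau>. b < x"
  shows "wt (words b \<tau>) = wt (words_hd b \<tau> (hd \<tau>)) + (\<Sum>i=1..b. wt (words_hd b \<tau> i))"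
proof -
  have "b < hd \<tau>" using assms by auto
  have "words b \<tau> = (\<Union>i\<in>insert (hd \<tau>) {1..b}. words_hd b \<tau> i)"
  proof -
    have "hd \<pi> \<in> insert (hd \<tau>) {1..b}" if "\<pi> \<in> words b \<tau>" for \<pi>
      using hd_words[OF that assms(1)] by simp
    then show ?thesis unfolding words_hd_def by blast
  qed
  then have "wt (words b \<tau>) = (\<Sum>i\<in>insert (hd \<tau>) {1..b}. wt (words_hd b \<tau> i))"
    unfolding wt_def by (simp only:) (rule sum.UNION_disjoint, auto simp: words_hd_def)
  also have "\<dots> = wt (words_hd b \<tau> (hd \<tau>)) + (\<Sum>i=1..b. wt (words_hd b \<tau> i))"
    using \<open>b < hd \<tau>\<close> by (subst sum.insert) auto
  finally show ?thesis .
qed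

lemma wt_Cons: "wt ((#) c ` A) = (\<Sum>\<pi>\<in>A. indet_q ^ (of_bool (\<pi> \<noteq> [] \<and> hd \<pi> < c) + desc \<pi>))"
  unfolding wt_def by (subst sum.reindex) (auto simp: desc_Cons)

text \<open>As \<open>b < c < hd \<tau>\<close>, prepending \<open>c\<close> creates a descent
  exactly when the next letter is small. The second term corrects for the words that begin with
  \<open>hd \<tau>\<close>.\<close>

lemma wt_Cons_words:
  assumes "\<tau> \<noteq> []" "\<forall>x\<in>set \<tau>. b < x" "b < c" "c < hd \<tau>"
  shows "wt ((#) c ` words b \<tau>) = indet_q * wt (words b \<tau>) + (1 - indet_q) * wt (words_hd b \<tau> (hd \<tau>))"
proof -
  let ?A = "words_hd b \<tau> (hd \<tau>)" and ?B = "words b \<tau> - words_hd b \<tau> (hd \<tau>)"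
  have sub: "?A \<subseteq> words b \<tau>" by (auto simp: words_hd_def)
  have "wt ((#) c ` words b \<tau>) = (\<Sum>\<pi>\<in>?B. indet_q * indet_q ^ desc \<pi>) + (\<Sum>\<pi>\<in>?A. indet_q ^ desc \<pi>)"
    unfolding wt_Cons sum.subset_diff[OF sub finite_words]
  proof (intro arg_cong2[of _ _ _ _ "(+)"] sum.cong refl)
    fix \<pi> assume "\<pi> \<in> ?B"
    then have "hd \<pi> \<in> {1..b}" "\<pi> \<noteq> []"
      using hd_words[of \<pi> b \<tau>] words_nonempty assms by (auto simp: words_hd_def)
    then show "indet_q ^ (of_bool (\<pi> \<noteq> [] \<and> hd \<pi> < c) + desc \<pi>) = indet_q * indet_q ^ desc \<pi>"
      using assms by auto
  next
    fix \<pi> assume "\<pi> \<in> ?A"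
    then show "indet_q ^ (of_bool (\<pi> \<noteq> [] \<and> hd \<pi> < c) + desc \<pi>) = indet_q ^ desc \<pi>"
      using assms by (auto simp: words_hd_def)
  qed
  also have "(\<Sum>\<pi>\<in>?B. indet_q * indet_q ^ desc \<pi>) = indet_q * (wt (words b \<tau>) - wt ?A)"
    by (simp add: wt_def sum.subset_diff[OF sub finite_words] sum_distrib_left)
  finally show ?thesis by (simp add: wt_def algebra_simps)
qed

text \<open>Every letter that can follow \<open>c\<close> is smaller, so each word gains one
  descent. The last assumption excludes the empty word.\<close>

lemma wt_Cons_words_desc:
  assumes "\<tau> \<noteq> [] \<Longrightarrow> hd \<tau> < c" "b < c" "b \<noteq> 0 \<or> \<tau> \<noteq> []"
  shows "wt ((#) c ` words b \<tau>) = indet_q * wt (words b \<tau>)"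
proof -
  have "\<pi> \<noteq> [] \<and> hd \<pi> < c" if \<pi>: "\<pi> \<in> words b \<tau>" for \<pi>
  proof -
    have ne: "\<pi> \<noteq> []" using \<pi> assms(3) by (auto simp: words_def)
    then have "hd \<pi> \<in> {1..b} \<union> set \<tau>" using \<pi> by (auto simp: words_def)
    then show ?thesis using hd_words[OF \<pi>] assms ne by (cases "\<tau> = []") auto
  qed
  then show ?thesis
    unfolding wt_Cons by (simp add: wt_def sum_distrib_left)
qed


section \<open>Dependence on the number of layers\<close>

text \<open>A single layer of \<open>k\<close> letters just above \<open>b\<close>, the
  representative with which other layered words of that length are compared.\<close>

definition dec :: "nat \<Rightarrow> nat \<Rightarrow> nat list" where
  "dec b k = rev [b + 1..<b + k + 1]"

lemma dec_0 [simp]: "dec b 0 = []"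
  by (simp add: dec_def)

lemma dec_Suc [simp]: "dec b (Suc k) = Suc (b + k) # dec b k"
  by (simp add: dec_def)

lemma length_dec [simp]: "length (dec b k) = k"
  by (induction k) auto

lemma set_dec [simp]: "set (dec b k) = {b<..b + k}"
  by (auto simp: dec_def)

lemma distinct_dec [simp]: "distinct (dec b k)"
  by (simp add: dec_def)

lemma sorted_dec: "sorted_wrt (>) (dec b k)"
  by (induction k) auto

lemma layered_sorted: "sorted_wrt (>) \<tau> \<Longrightarrow> layered \<tau>"
  unfolding layered_def
proof clarify
  fix x y z
  assume *: "sorted_wrt (>) \<tau>" "subseq [x,y,z] \<tau>" "z < x \<and> x < y \<or> y < z \<and> z < x"
  have "subseq [x,y] \<tau>" "subseq [y,z] \<tau>"
    using *(2) by (auto intro: subseq_order.trans[of _ "[x,y,z]"])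
  then have "y < x" "z < y" using *(1) by (auto simp: sorted_wrt_iff_subseq)
  then show False using *(3) by linarith
qed

lemma layered_dec [simp]: "layered (dec b k)"
  using sorted_dec by (rule layered_sorted)

lemma asc_dec [simp]: "asc (dec b k) = 0"
  using sorted_dec by (rule asc_sorted)

lemma wt_singleton [simp]: "wt {[c]} = 1"
  by (simp add: wt_def desc_def)

lemma indet_q_nonzero [simp]: "indet_q \<noteq> 0"
  by (simp add: indet_q_def)

text \<open>At \<open>b = k = 0\<close> the value \<open>1/q\<close> makes the recurrence for \<open>dec_wt\<close> hold without exception.\<close>

definition dec_wt :: "nat \<Rightarrow> nat \<Rightarrow> ratfun" where
  "dec_wt b k = (if b = 0 \<and> k = 0 then inverse indet_q else wt (words b (dec b k)))"

text \<open>The effect of \<open>r\<close> further layers on a weight \<open>F k\<close> of words with \<open>k\<close> large letters in a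
  single layer: each of them acts as the operator \<open>1 + (1 - q) \<Delta>\<close>, where \<open>\<Delta>\<close> removes a large letter.\<close>

primrec add_layers :: "(nat \<Rightarrow> ratfun) \<Rightarrow> nat \<Rightarrow> nat \<Rightarrow> ratfun" where
  "add_layers F 0 k = F k"
| "add_layers F (Suc r) k = add_layers F r k + (1 - indet_q) * add_layers F r (k - 1)"

text \<open>Induction on \<open>r\<close>. For \<open>Suc r < k\<close> the recurrence is applied at
  \<open>k \<ge> 2\<close>, where \<open>k - 1\<close> is a true predecessor and
  \<open>r < k - 1\<close> still holds.\<close>

lemma add_layers_eqI:
  assumes "\<And>k. 1 \<le> k \<Longrightarrow> F k = X 0 k"
    and "\<And>r k. r + 2 \<le> k \<Longrightarrow> X (Suc r) k = X r k + (1 - indet_q) * X r (k - 1)"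
  shows "r < k \<Longrightarrow> add_layers F r k = X r k"
  by (induction r arbitrary: k) (simp_all add: assms)

definition admissible :: "nat \<Rightarrow> nat list \<Rightarrow> bool" where
  "admissible b \<tau> \<longleftrightarrow> layered \<tau> \<and> distinct \<tau> \<and> \<tau> \<noteq> [] \<and> (\<forall>x\<in>set \<tau>. b < x)"

lemma admissible_dec: "1 \<le> k \<Longrightarrow> admissible b (dec b k)"
  by (cases k) (simp_all add: admissible_def del: dec_Suc, auto)

definition dec_hd_wt :: "nat \<Rightarrow> nat \<Rightarrow> nat \<Rightarrow> ratfun" where
  "dec_hd_wt b i k = wt (words_hd b (dec b k) i)"

text \<open>The induction hypothesis in \<open>b\<close>. It concerns small first letters only; the
  words beginning with \<open>hd \<tau>\<close> and the total weight then follow by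
  \<open>wt_words_layered\<close>.\<close>

definition layers_invariant :: "nat \<Rightarrow> bool" where
  "layers_invariant b \<longleftrightarrow> (\<forall>\<tau> i. admissible b \<tau> \<longrightarrow> 1 \<le> i \<longrightarrow> i \<le> b \<longrightarrow>
      wt (words_hd b \<tau> i) = add_layers (dec_hd_wt b i) (asc \<tau>) (length \<tau>))"

text \<open>The top letter is followed by a smaller one, which gives the factor q. For
  \<open>b = k = 0\<close> nothing follows, and the value 1/q of \<open>dec_wt 0 0\<close> restores
  the weight 1.\<close>

lemma wt_words_hd_dec: "wt (words_hd b (dec b (Suc k)) (Suc (b + k))) = indet_q * dec_wt b k"
proof (cases "b = 0 \<and> k = 0")
  case True
  have "words_hd b (dec b (Suc k)) (Suc (b + k)) = (#) (Suc (b + k)) ` words b (dec b k)"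
    unfolding dec_Suc using layered_dec[of b "Suc k"] distinct_dec[of b "Suc k"]
    by (intro words_hd_top) auto
  then show ?thesis using True by (simp add: dec_wt_def words_empty wt_Cons)
next
  case False
  have "words_hd b (dec b (Suc k)) (Suc (b + k)) = (#) (Suc (b + k)) ` words b (dec b k)"
    unfolding dec_Suc using layered_dec[of b "Suc k"] distinct_dec[of b "Suc k"]
    by (intro words_hd_top) auto
  also have "wt \<dots> = indet_q * wt (words b (dec b k))"
    using False by (intro wt_Cons_words_desc) (cases k, auto)+
  also have "wt (words b (dec b k)) = dec_wt b k" using False by (auto simp: dec_wt_def)
  finally show ?thesis .
qed

lemma dec_wt_rec: "dec_wt b (Suc k) = indet_q * dec_wt b k + (\<Sum>i=1..b. dec_hd_wt b i (Suc k))"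
proof -
  have "dec_wt b (Suc k) = wt (words b (dec b (Suc k)))" by (simp add: dec_wt_def)
  also have "\<dots> = wt (words_hd b (dec b (Suc k)) (Suc (b + k))) + (\<Sum>i=1..b. wt (words_hd b (dec b (Suc k)) i))"
    by (subst wt_words) auto
  finally show ?thesis by (simp only: wt_words_hd_dec dec_hd_wt_def)
qed

text \<open>The recurrence \<open>dec_wt_rec\<close> is linear and hence survives each added
  layer.\<close>

lemma add_layers_rec:
  "r < k \<Longrightarrow> add_layers (dec_wt b) r k = indet_q * add_layers (dec_wt b) r (k - 1) + (\<Sum>i=1..b. add_layers (dec_hd_wt b i) r k)"
proof (rule add_layers_eqI[where F = "dec_wt b"
    and X = "\<lambda>r k. indet_q * add_layers (dec_wt b) r (k - 1) + (\<Sum>i=1..b. add_layers (dec_hd_wt b i) r k)"])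
  fix k :: nat assume "1 \<le> k"
  then show "dec_wt b k = indet_q * add_layers (dec_wt b) 0 (k - 1) + (\<Sum>i=1..b. add_layers (dec_hd_wt b i) 0 k)"
    by (cases k) (simp_all add: dec_wt_rec)
next
  fix r k :: nat
  show "indet_q * add_layers (dec_wt b) (Suc r) (k - 1) + (\<Sum>i=1..b. add_layers (dec_hd_wt b i) (Suc r) k) =
     indet_q * add_layers (dec_wt b) r (k - 1) + (\<Sum>i=1..b. add_layers (dec_hd_wt b i) r k) +
     (1 - indet_q) * (indet_q * add_layers (dec_wt b) r (k - 1 - 1) + (\<Sum>i=1..b. add_layers (dec_hd_wt b i) r (k - 1)))"
    by (simp add: sum.distrib sum_subtractf algebra_simps sum_distrib_left)
qed

text \<open>Induction on \<open>\<tau>\<close> by deleting its first letter \<open>c\<close>. Words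
  beginning with \<open>c\<close> reduce to words for the shorter \<open>\<tau>\<close>, the other
  words are covered by the invariant, and \<open>add_layers_rec\<close> combines both.\<close>

lemma wt_words_layered:
  assumes "layers_invariant b" "admissible b \<tau>"
  shows "wt (words b \<tau>) = add_layers (dec_wt b) (asc \<tau>) (length \<tau>)
    \<and> wt (words_hd b \<tau> (hd \<tau>)) = indet_q * add_layers (dec_wt b) (asc \<tau>) (length \<tau> - 1)"
  using assms(2)
proof (induction \<tau>)
  case Nil
  then show ?case by (simp add: admissible_def)
next
  case (Cons c \<tau>)
  have adm: "layered (c # \<tau>)" "distinct (c # \<tau>)" "\<forall>x\<in>set (c # \<tau>). b < x"
    using Cons.prems by (auto simp: admissible_def)
  have "layered \<tau>" using adm(1) by (rule layered_subseq) auto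
  then have adm': "admissible b \<tau>" if "\<tau> \<noteq> []" using that adm by (simp add: admissible_def)
  have top: "words_hd b (c # \<tau>) c = (#) c ` words b \<tau>" using adm by (rule words_hd_top)
  have 1: "wt (words_hd b (c # \<tau>) c) = indet_q * add_layers (dec_wt b) (asc (c # \<tau>)) (length \<tau>)"
  proof (cases "\<tau> = []")
    case True
    show ?thesis
    proof (cases "b = 0")
      case False
      then have "wt (words_hd b (c # \<tau>) c) = indet_q * wt (words b \<tau>)"
        unfolding top using adm True by (intro wt_Cons_words_desc) auto
      then show ?thesis using True False by (simp add: dec_wt_def)
    qed (use True top in \<open>simp add: dec_wt_def words_empty wt_Cons\<close>)
  next
    case False
    note IH = Cons.IH[OF adm'[OF False]]
    show ?thesis
    proof (cases "hd \<tau> < c")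
      case True
      then have "wt (words_hd b (c # \<tau>) c) = indet_q * wt (words b \<tau>)"
        unfolding top using adm False by (intro wt_Cons_words_desc) auto
      then show ?thesis using IH True False by (simp add: asc_Cons_greater)
    next
      \<comment> \<open>Here \<open>c\<close> is a layer of its own. With F =
        \<open>add_layers (dec_wt b) (asc \<tau>)\<close> the weight is q F k + (1 - q) q F (k - 1),
        which is q times the effect of one more layer on F at k =
        \<open>length \<tau>\<close>.\<close>
      case ne: False
      have "hd \<tau> \<noteq> c" using adm(2) False by (cases \<tau>) auto
      then have lt: "c < hd \<tau>" using ne by simp
      then have "wt (words_hd b (c # \<tau>) c) = indet_q * wt (words b \<tau>) + (1 - indet_q) * wt (words_hd b \<tau> (hd \<tau>))"
        unfolding top using adm False by (intro wt_Cons_words) auto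
      then show ?thesis using IH lt False by (simp add: asc_Cons_less algebra_simps)
    qed
  qed
  have "wt (words b (c # \<tau>)) = wt (words_hd b (c # \<tau>) c) + (\<Sum>i=1..b. wt (words_hd b (c # \<tau>) i))"
    using wt_words[of "c # \<tau>" b] adm(3) by simp
  also have "\<dots> = add_layers (dec_wt b) (asc (c # \<tau>)) (length (c # \<tau>))"
    using add_layers_rec[OF asc_less_length, of "c # \<tau>" b] 1 assms(1) Cons.prems
    by (simp add: layers_invariant_def)
  finally show ?case using 1 by simp
qed

text \<open>A first letter \<open>Suc b\<close> acts like one more layer, because
  \<open>hd \<tau>\<close> can follow it without a descent. For a first letter
  \<open>i \<le> b\<close>, the two summands come from inserting \<open>Suc b\<close> into
  \<open>\<tau>\<close> as a new layer or into the first layer.\<close>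

lemma wt_words_hd_Suc:
  assumes "layers_invariant b" "admissible (Suc b) \<tau>"
  shows "wt (words_hd (Suc b) \<tau> (Suc b)) = indet_q * add_layers (dec_wt b) (Suc (asc \<tau>)) (length \<tau>)"
    and "1 \<le> i \<Longrightarrow> i \<le> b \<Longrightarrow> wt (words_hd (Suc b) \<tau> i) =
      add_layers (dec_hd_wt b i) (Suc (asc \<tau>)) (Suc (length \<tau>)) + add_layers (dec_hd_wt b i) (asc \<tau>) (Suc (length \<tau>))"
proof -
  have adm: "layered \<tau>" "distinct \<tau>" "\<tau> \<noteq> []" "\<forall>x\<in>set \<tau>. Suc b < x"
    using assms(2) by (auto simp: admissible_def)
  then have hd: "Suc b < hd \<tau>" by auto
  have adm': "admissible b \<tau>" using assms(2) by (auto simp: admissible_def)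
  have "wt (words_hd (Suc b) \<tau> (Suc b)) = indet_q * wt (words b \<tau>) + (1 - indet_q) * wt (words_hd b \<tau> (hd \<tau>))"
    unfolding words_hd_bottom[OF adm(1,4)] using adm hd by (intro wt_Cons_words) auto
  then show "wt (words_hd (Suc b) \<tau> (Suc b)) = indet_q * add_layers (dec_wt b) (Suc (asc \<tau>)) (length \<tau>)"
    using wt_words_layered[OF assms(1) adm'] by (simp add: algebra_simps)
  assume i: "1 \<le> i" "i \<le> b"
  obtain \<tau>' where \<tau>': "{\<rho>. layered \<rho> \<and> distinct \<rho> \<and> set \<rho> = insert (Suc b) (set \<tau>) \<and>
      filter (\<lambda>x. Suc b < x) \<rho> = \<tau>} = {Suc b # \<tau>, \<tau>'}" "\<tau>' \<noteq> Suc b # \<tau>" "asc \<tau>' = asc \<tau>"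
      "length \<tau>' = Suc (length \<tau>)"
    using layered_insert_min[OF adm] by blast
  have adms: "admissible b \<rho>" if "\<rho> \<in> {Suc b # \<tau>, \<tau>'}" for \<rho>
  proof -
    have "layered \<rho>" "distinct \<rho>" "set \<rho> = insert (Suc b) (set \<tau>)"
      using that unfolding \<tau>'(1)[symmetric] by simp_all
    moreover have "\<rho> \<noteq> []" using calculation(3) by auto
    moreover have "\<forall>x\<in>set \<tau>. b < x" using adm(4) by (simp add: Suc_lessD)
    ultimately show ?thesis by (simp add: admissible_def)
  qed
  have "words_hd (Suc b) \<tau> i = words_hd b (Suc b # \<tau>) i \<union> words_hd b \<tau>' i"
    using words_hd_step[OF adm i \<tau>'(1)] by simp
  moreover have "words_hd b (Suc b # \<tau>) i \<inter> words_hd b \<tau>' i = {}"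
    using \<tau>'(2) by (auto simp: words_hd_def words_def)
  ultimately have "wt (words_hd (Suc b) \<tau> i) = wt (words_hd b (Suc b # \<tau>) i) + wt (words_hd b \<tau>' i)"
    by (simp add: wt_def sum.union_disjoint)
  then show "wt (words_hd (Suc b) \<tau> i) =
      add_layers (dec_hd_wt b i) (Suc (asc \<tau>)) (Suc (length \<tau>)) + add_layers (dec_hd_wt b i) (asc \<tau>) (Suc (length \<tau>))"
    using assms(1) adms[of "Suc b # \<tau>"] adms[of \<tau>'] i \<tau>'(3,4) asc_Cons_less[OF adm(3) hd]
    unfolding layers_invariant_def by simp
qed

text \<open>The weights found in \<open>wt_words_hd_Suc\<close> obey the recurrence of
  \<open>add_layers\<close> in the number of layers, so they are determined by the case of the
  single layer \<open>dec (Suc b) k\<close>.\<close>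

lemma layers_invariant_Suc:
  assumes "layers_invariant b"
  shows "layers_invariant (Suc b)"
  unfolding layers_invariant_def
proof (intro allI impI)
  fix \<tau> i assume adm: "admissible (Suc b) \<tau>" and i: "1 \<le> i" "i \<le> Suc b"
  have lt: "asc \<tau> < length \<tau>" using adm by (auto simp: admissible_def intro: asc_less_length)
  show "wt (words_hd (Suc b) \<tau> i) = add_layers (dec_hd_wt (Suc b) i) (asc \<tau>) (length \<tau>)"
  proof (cases "i = Suc b")
    case True
    have "add_layers (dec_hd_wt (Suc b) i) (asc \<tau>) (length \<tau>) = indet_q * add_layers (dec_wt b) (Suc (asc \<tau>)) (length \<tau>)"
      by (rule add_layers_eqI[where X = "\<lambda>r k. indet_q * add_layers (dec_wt b) (Suc r) k"], unfold True)
        (simp_all add: lt dec_hd_wt_def wt_words_hd_Suc(1)[OF assms admissible_dec] del: dec_Suc, simp add: algebra_simps)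
    then show ?thesis using wt_words_hd_Suc(1)[OF assms adm] True by simp
  next
    case False
    then have ib: "i \<le> b" using i by simp
    have "add_layers (dec_hd_wt (Suc b) i) (asc \<tau>) (length \<tau>) =
        add_layers (dec_hd_wt b i) (Suc (asc \<tau>)) (Suc (length \<tau>)) + add_layers (dec_hd_wt b i) (asc \<tau>) (Suc (length \<tau>))"
    proof (rule add_layers_eqI[OF _ _ lt, where X = "\<lambda>r k. add_layers (dec_hd_wt b i) (Suc r) (Suc k) + add_layers (dec_hd_wt b i) r (Suc k)"])
      fix k :: nat assume "1 \<le> k"
      then show "dec_hd_wt (Suc b) i k = add_layers (dec_hd_wt b i) (Suc 0) (Suc k) + add_layers (dec_hd_wt b i) 0 (Suc k)"
        unfolding dec_hd_wt_def[of "Suc b"] by (subst wt_words_hd_Suc(2)[OF assms admissible_dec i(1) ib]) simp_all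
    next
      fix r k :: nat assume "r + 2 \<le> k"
      then obtain l where "k = Suc l" by (cases k) auto
      then show "add_layers (dec_hd_wt b i) (Suc (Suc r)) (Suc k) + add_layers (dec_hd_wt b i) (Suc r) (Suc k) =
          add_layers (dec_hd_wt b i) (Suc r) (Suc k) + add_layers (dec_hd_wt b i) r (Suc k) + (1 - indet_q) *
          (add_layers (dec_hd_wt b i) (Suc r) (Suc (k - 1)) + add_layers (dec_hd_wt b i) r (Suc (k - 1)))"
        by (simp add: algebra_simps)
    qed
    then show ?thesis using wt_words_hd_Suc(2)[OF assms adm i(1) ib] by simp
  qed
qed

lemma layers_invariant_all: "layers_invariant b"
  by (induction b) (simp add: layers_invariant_def, rule layers_invariant_Suc)

section \<open>Recurrences for a single layer of large letters\<close>

lemma dec_hd_wt_Suc_Suc: "1 \<le> k \<Longrightarrow> dec_hd_wt (Suc b) (Suc b) k = indet_q * (dec_wt b k + (1 - indet_q) * dec_wt b (k - 1))"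
  unfolding dec_hd_wt_def by (subst wt_words_hd_Suc(1)[OF layers_invariant_all admissible_dec]) simp_all

text \<open>With F = \<open>dec_hd_wt b i\<close>, inserting \<open>Suc b\<close> as a new layer
  contributes F (k + 1) + (1 - q) F k, and inserting it into the single layer contributes another F
  (k + 1).\<close>

lemma dec_hd_wt_Suc: "1 \<le> k \<Longrightarrow> 1 \<le> i \<Longrightarrow> i \<le> b \<Longrightarrow>
    dec_hd_wt (Suc b) i k = 2 * dec_hd_wt b i (Suc k) + (1 - indet_q) * dec_hd_wt b i k"
  unfolding dec_hd_wt_def[of "Suc b"] by (subst wt_words_hd_Suc(2)[OF layers_invariant_all admissible_dec]) simp_all

lemma dec_wt_0: "dec_wt 0 (Suc k) = indet_q ^ k"
proof (induction k)
  case 0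
  show ?case using dec_wt_rec[of 0 0] by (simp add: dec_wt_def)
next
  case (Suc k)
  then show ?case using dec_wt_rec[of 0 "Suc k"] by simp
qed

text \<open>Counting the letter \<open>Suc b\<close> as the only large letter imposes no condition
  on its position.\<close>

lemma dec_wt_Suc_0: "dec_wt (Suc b) 0 = dec_wt b (Suc 0)"
proof -
  have "words (Suc b) [] = words b [Suc b]"
  proof (intro equalityI subsetI)
    fix \<pi> assume \<pi>: "\<pi> \<in> words (Suc b) []"
    let ?\<rho> = "filter (\<lambda>x. b < x) \<pi>"
    have "set ?\<rho> = {Suc b}" "distinct ?\<rho>" using \<pi> by (auto simp: words_def)
    then have "length ?\<rho> = 1" using distinct_card[of ?\<rho>] by simp
    then have "?\<rho> = [Suc b]" using \<open>set ?\<rho> = {Suc b}\<close> by (cases ?\<rho>) auto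
    then show "\<pi> \<in> words b [Suc b]" using \<pi> by (simp add: words_def atLeastAtMostSuc_conv)
  next
    fix \<pi> assume "\<pi> \<in> words b [Suc b]"
    then show "\<pi> \<in> words (Suc b) []" by (auto simp: words_def atLeastAtMostSuc_conv filter_empty_conv)
  qed
  then show ?thesis by (simp add: dec_wt_def)
qed

text \<open>Sum the recurrences for \<open>dec_hd_wt\<close> over the first letter and eliminate the
  sums by \<open>dec_wt_rec\<close>. The terms in \<open>dec_wt b k\<close> cancel, which leaves a
  recurrence for the totals alone.\<close>

lemma dec_wt_Suc:
  "dec_wt (Suc b) (Suc k) = 2 * dec_wt b (Suc (Suc k)) + (1 - 2 * indet_q) * dec_wt b (Suc k) + indet_q * dec_wt (Suc b) k"
proof -
  have "(\<Sum>i=1..Suc b. dec_hd_wt (Suc b) i (Suc k)) = (\<Sum>i=1..b. dec_hd_wt (Suc b) i (Suc k)) + dec_hd_wt (Suc b) (Suc b) (Suc k)"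
    by simp
  also have "(\<Sum>i=1..b. dec_hd_wt (Suc b) i (Suc k)) =
      2 * (\<Sum>i=1..b. dec_hd_wt b i (Suc (Suc k))) + (1 - indet_q) * (\<Sum>i=1..b. dec_hd_wt b i (Suc k))"
    by (simp add: dec_hd_wt_Suc sum.distrib sum_distrib_left)
  also have "(\<Sum>i=1..b. dec_hd_wt b i (Suc (Suc k))) = dec_wt b (Suc (Suc k)) - indet_q * dec_wt b (Suc k)"
    by (simp add: dec_wt_rec)
  also have "(\<Sum>i=1..b. dec_hd_wt b i (Suc k)) = dec_wt b (Suc k) - indet_q * dec_wt b k"
    by (simp add: dec_wt_rec)
  finally show ?thesis
    by (simp add: dec_wt_rec[of "Suc b" k] dec_hd_wt_Suc_Suc algebra_simps)
qed


section \<open>The refinements in terms of words\<close>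

text \<open>A subsequence with exactly the letters satisfying \<open>P\<close> is as long as the
  filtered word and therefore equal to it. This turns the order condition on the top m letters into
  a condition on a filter.\<close>

lemma subseq_iff_filter:
  assumes "distinct \<pi>" "distinct xs" "set xs = {x \<in> set \<pi>. P x}"
  shows "subseq xs \<pi> \<longleftrightarrow> filter P \<pi> = xs"
proof
  assume "subseq xs \<pi>"
  then have "subseq xs (filter P \<pi>)" using assms(3) by (simp add: subseq_filter_iff)
  moreover have "length xs = length (filter P \<pi>)"
    using assms by (metis distinct_card distinct_filter set_filter)
  ultimately show "filter P \<pi> = xs" by (metis subseq_same_length)
next
  assume "filter P \<pi> = xs"
  then show "subseq xs \<pi>" by (metis subseq_filter_left)
qed

lemma avoiders_eq: "avoiders n = {\<pi>. distinct \<pi> \<and> set \<pi> = {1..n} \<and> good \<pi>}"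
  unfolding avoiders_def avoids_iff_good by (auto simp: permutations_of_set_def)

lemma D_set_eq:
  assumes "1 \<le> m" "m \<le> n" "1 \<le> i" "i \<le> n"
  shows "D_set n i m = words_hd (n - m) (dec (n - m) m) i"
proof -
  have r: "rev [n - m + 1..<n + 1] = dec (n - m) m" using assms(2) by (simp add: dec_def)
  have s: "{1..n - m} \<union> set (dec (n - m) m) = {1..n}" using assms(2) by auto
  have "subseq (dec (n - m) m) \<pi> \<longleftrightarrow> filter (\<lambda>x. n - m < x) \<pi> = dec (n - m) m"
    if "distinct \<pi>" "set \<pi> = {1..n}" for \<pi>
    using that assms(2) by (intro subseq_iff_filter) auto
  then show ?thesis
    using assms unfolding D_set_def avoiders_eq words_hd_def words_def r s by auto
qed

lemma D_all_iff:
  assumes "1 \<le> m" "m \<le> n"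
  shows "\<pi> \<in> D_all n m \<longleftrightarrow> distinct \<pi> \<and> set \<pi> = {1..n} \<and> good \<pi>
    \<and> filter (\<lambda>x. n - m < x) \<pi> = dec (n - m) m"
proof -
  have s: "{1..n - m} \<union> set (dec (n - m) m) = {1..n}" using assms(2) by auto
  have hd: "hd \<pi> \<in> {1..n}" if "set \<pi> = {1..n}"
    using that assms hd_in_set[of \<pi>] by fastforce
  have "D_all n m = (\<Union>i\<in>{1..n}. words_hd (n - m) (dec (n - m) m) i)"
    unfolding D_all_def using assms by (intro SUP_cong refl D_set_eq) auto
  then show ?thesis
    using hd unfolding words_hd_def words_def s by auto
qed

lemma D_all_eq: "1 \<le> m \<Longrightarrow> m \<le> n \<Longrightarrow> D_all n m = words (n - m) (dec (n - m) m)"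
proof (rule set_eqI)
  fix \<pi> assume mn: "1 \<le> m" "m \<le> n"
  have s: "{1..n - m} \<union> set (dec (n - m) m) = {1..n}" using mn by auto
  show "\<pi> \<in> D_all n m \<longleftrightarrow> \<pi> \<in> words (n - m) (dec (n - m) m)"
    unfolding D_all_iff[OF mn] words_def s by simp
qed

lemma d_small: "1 \<le> i \<Longrightarrow> 1 \<le> m \<Longrightarrow> i + m \<le> n \<Longrightarrow> d n i m = dec_hd_wt (n - m) i m"
  by (simp add: d_def D_set_eq dec_hd_wt_def wt_def)

lemma d_top:
  assumes "1 \<le> m" "m \<le> n"
  shows "d n n m = indet_q * dec_wt (n - m) (m - 1)"
  using wt_words_hd_dec[of "n - m" "m - 1"] assms
  by (simp add: d_def D_set_eq wt_def[symmetric] del: dec_Suc)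

text \<open>The top m letters occur in decreasing order, so a first letter above
  \<open>n - m\<close> can only be \<open>n\<close>.\<close>

lemma d_between:
  assumes "1 \<le> m" "m \<le> n" "n - m < i" "i < n"
  shows "d n i m = 0"
proof -
  have "hd \<pi> = n \<or> hd \<pi> \<in> {1..n - m}" if "\<pi> \<in> words (n - m) (dec (n - m) m)" for \<pi>
    using hd_words[OF that] assms by (cases m) auto
  then have "words_hd (n - m) (dec (n - m) m) i = {}"
    using assms by (fastforce simp: words_hd_def)
  then show ?thesis using assms by (simp add: d_def D_set_eq)
qed

section \<open>Splitting off a final permutation of [a]\<close>

lemma dec_plus: "map (\<lambda>x. x + a) (dec b k) = dec (b + a) k"
  by (induction k) auto

lemma layered_map_plus: "layered (map (\<lambda>x. x + a) \<tau>) \<longleftrightarrow> layered \<tau>"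
proof
  assume l: "layered (map (\<lambda>x. x + a) \<tau>)"
  show "layered \<tau>"
    unfolding layered_def
  proof clarify
    fix x y z assume "subseq [x,y,z] \<tau>" and o: "z < x \<and> x < y \<or> y < z \<and> z < x"
    then have "subseq (map (\<lambda>x. x + a) [x,y,z]) (map (\<lambda>x. x + a) \<tau>)" by (intro subseq_map)
    then show False using layeredD[OF l, of "x + a" "y + a" "z + a"] o by auto
  qed
next
  assume l: "layered \<tau>"
  show "layered (map (\<lambda>x. x + a) \<tau>)"
    unfolding layered_def
  proof clarify
    fix x y z assume ss: "subseq [x,y,z] (map (\<lambda>x. x + a) \<tau>)" and o: "z < x \<and> x < y \<or> y < z \<and> z < x"
    have "subseq (map (\<lambda>x. x - a) [x,y,z]) (map (\<lambda>x. x - a) (map (\<lambda>x. x + a) \<tau>))"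
      using ss by (intro subseq_map)
    then have "subseq [x - a, y - a, z - a] \<tau>" by (simp add: comp_def)
    moreover have "a \<le> x" "a \<le> y" "a \<le> z" using subseq_set[OF ss] by auto
    ultimately show False using layeredD[OF l, of "x - a" "y - a" "z - a"] o by linarith
  qed
qed

text \<open>No letter of the shifted \<open>\<rho>\<close> has a larger letter in
  \<open>\<sigma>\<close>, so by \<open>good_Cons\<close> the condition at each of its letters is
  the one within \<open>\<rho>\<close>.\<close>

lemma good_join:
  assumes "\<forall>x\<in>set \<sigma>. x \<le> a" "\<forall>x\<in>set \<rho>. 1 \<le> x"
  shows "good (map (\<lambda>x. x + a) \<rho> @ \<sigma>) \<longleftrightarrow> good \<rho> \<and> good \<sigma>"
  using assms(2)
proof (induction \<rho>)
  case (Cons c \<rho>)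
  have "filter (\<lambda>x. c + a < x) \<sigma> = []"
    using assms(1) by (auto simp: filter_empty_conv)
  moreover have "filter (\<lambda>x. c + a < x) (map (\<lambda>x. x + a) \<rho>) = map (\<lambda>x. x + a) (filter (\<lambda>x. c < x) \<rho>)"
    by (simp add: filter_map comp_def)
  ultimately show ?case
    using Cons by (simp add: good_Cons layered_map_plus)
qed simp

lemma desc_map_plus: "desc (map (\<lambda>x. x + a) \<rho>) = desc \<rho>"
  by (induction \<rho>) (auto simp: desc_Cons hd_map)

lemma desc_append: "\<rho> \<noteq> [] \<Longrightarrow> \<sigma> \<noteq> [] \<Longrightarrow> hd \<sigma> < last \<rho> \<Longrightarrow> desc (\<rho> @ \<sigma>) = Suc (desc \<rho> + desc \<sigma>)"
proof (induction \<rho>)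
  case (Cons c \<rho>)
  have "desc [] = 0" by (simp add: desc_def)
  then show ?case using Cons by (cases "\<rho> = []") (auto simp: desc_Cons)
qed simp

lemma join_D_all:
  assumes "1 \<le> m" "a + m \<le> n" "\<rho> \<in> D_all (n - a) m" "\<sigma> \<in> words a []"
  shows "map (\<lambda>x. x + a) \<rho> @ \<sigma> \<in> D_all n m"
proof -
  have \<rho>: "distinct \<rho>" "set \<rho> = {1..n - a}" "good \<rho>" "filter (\<lambda>x. n - a - m < x) \<rho> = dec (n - a - m) m"
    using assms by (auto simp: D_all_iff)
  have \<sigma>: "distinct \<sigma>" "set \<sigma> = {1..a}" "good \<sigma>" using assms(4) by (auto simp: words_def)
  have im: "(\<lambda>x. x + a) ` {1..n - a} = {a + 1..n}"
    using assms(2) image_add_atLeastAtMost'[of a 1 "n - a"] by (simp add: add.commute)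
  have "filter (\<lambda>x. n - m < x) (map (\<lambda>x. x + a) \<rho>) = map (\<lambda>x. x + a) (filter (\<lambda>x. n - a - m < x) \<rho>)"
    unfolding filter_map comp_def using assms(2) by (intro arg_cong[of _ _ "map _"] filter_cong) auto
  also have "\<dots> = dec (n - m) m" unfolding \<rho>(4) dec_plus using assms(2) by simp
  finally have 1: "filter (\<lambda>x. n - m < x) (map (\<lambda>x. x + a) \<rho>) = dec (n - m) m" .
  have 2: "filter (\<lambda>x. n - m < x) \<sigma> = []" using assms(2) by (auto simp: filter_empty_conv \<sigma>)
  have "good (map (\<lambda>x. x + a) \<rho> @ \<sigma>)" using good_join[of \<sigma> a \<rho>] \<rho> \<sigma> by auto
  moreover have "distinct (map (\<lambda>x. x + a) \<rho> @ \<sigma>)"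
    using \<rho> \<sigma> by (auto simp: distinct_map inj_on_def)
  moreover have "set (map (\<lambda>x. x + a) \<rho> @ \<sigma>) = {1..n}"
    using im assms(2) by (auto simp: \<rho> \<sigma>)
  ultimately show ?thesis using assms(1,2) 1 2 by (subst D_all_iff) auto
qed

lemma split_D_all:
  assumes "1 \<le> m" "m \<le> n" "\<tau> @ \<sigma> \<in> D_all n m" "{n - m + 1..n} \<subseteq> set \<tau>" "set \<sigma> = {1..a}"
  shows "a + m \<le> n" "\<sigma> \<in> words a []" "\<exists>\<rho>\<in>D_all (n - a) m. \<tau> = map (\<lambda>x. x + a) \<rho>"
proof -
  have D: "distinct (\<tau> @ \<sigma>)" "set (\<tau> @ \<sigma>) = {1..n}" "good (\<tau> @ \<sigma>)"
    "filter (\<lambda>x. n - m < x) (\<tau> @ \<sigma>) = dec (n - m) m"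
    using assms by (auto simp: D_all_iff)
  show am: "a + m \<le> n"
  proof (rule ccontr)
    \<comment> \<open>Otherwise \<open>n - m + 1 \<le> a\<close>, and this letter would occur in
      both parts.\<close>
    assume "\<not> a + m \<le> n"
    then have "n - m + 1 \<in> set \<sigma>" using assms(1,2,5) by auto
    moreover have "n - m + 1 \<in> set \<tau>" using assms(1,2,4) by auto
    ultimately show False using D(1) by auto
  qed
  have "good \<sigma>" using D(3) by (rule good_subseq) auto
  then show "\<sigma> \<in> words a []" using D(1) assms(5) by (auto simp: words_def filter_empty_conv)
  have \<tau>: "set \<tau> = {a + 1..n}"
  proof -
    have "set \<tau> = {1..n} - {1..a}" using D(1,2) assms(5) by auto
    also have "\<dots> = {a + 1..n}" by auto
    finally show ?thesis .
  qed
  define \<rho> where "\<rho> = map (\<lambda>x. x - a) \<tau>"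
  have m\<rho>: "\<tau> = map (\<lambda>x. x + a) \<rho>" using \<tau> by (auto simp: \<rho>_def intro!: map_idI[symmetric])
  have s\<rho>: "set \<rho> = {1..n - a}"
  proof -
    have "(\<lambda>x. x + a) ` set \<rho> = (\<lambda>x. x + a) ` {1..n - a}"
      using \<tau> am image_add_atLeastAtMost'[of a 1 "n - a"] by (simp add: m\<rho> add.commute)
    then show ?thesis by (subst (asm) inj_image_eq_iff) (auto simp: inj_def)
  qed
  have d\<rho>: "distinct \<rho>" using D(1) by (simp add: m\<rho> distinct_map)
  have "good \<tau>" using D(3) by (rule good_subseq) auto
  then have good\<rho>: "good \<rho>" using good_join[of "[]" a \<rho>] s\<rho> by (auto simp: m\<rho>)
  have "map (\<lambda>x. x + a) (filter (\<lambda>x. n - a - m < x) \<rho>) = filter (\<lambda>x. n - m < x) \<tau>"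
    unfolding m\<rho> filter_map comp_def using am by (intro arg_cong[of _ _ "map _"] filter_cong) auto
  also have "\<dots> = filter (\<lambda>x. n - m < x) (\<tau> @ \<sigma>)"
    using am assms(5) by (auto simp: filter_empty_conv)
  also have "\<dots> = map (\<lambda>x. x + a) (dec (n - a - m) m)"
    unfolding D(4) dec_plus using am by simp
  finally have "filter (\<lambda>x. n - a - m < x) \<rho> = dec (n - a - m) m"
    by (subst (asm) inj_map_eq_map) (auto simp: inj_def)
  then have "\<rho> \<in> D_all (n - a) m"
    using am assms(1) s\<rho> d\<rho> good\<rho> by (subst D_all_iff) auto
  then show "\<exists>\<rho>\<in>D_all (n - a) m. \<tau> = map (\<lambda>x. x + a) \<rho>" using m\<rho> by blast
qed

text \<open>Indecomposability in standardized form: splitting off a permutation of [a] leaves a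
  shift by \<open>a\<close> of a member of \<open>D_all (n - a) m\<close>.\<close>

lemma E_set_iff:
  assumes "1 \<le> m" "m \<le> n"
  shows "\<pi> \<in> E_set n m \<longleftrightarrow> \<pi> \<in> D_all n m \<and>
    \<not> (\<exists>a \<rho> \<sigma>. 1 \<le> a \<and> a + m \<le> n \<and> \<rho> \<in> D_all (n - a) m \<and> \<sigma> \<in> words a [] \<and> \<pi> = map (\<lambda>x. x + a) \<rho> @ \<sigma>)"
    (is "_ \<longleftrightarrow> _ \<and> \<not> ?S")
proof (cases "\<pi> \<in> D_all n m")
  case True
  have "(\<exists>\<tau> \<sigma> a. a \<ge> 1 \<and> \<pi> = \<tau> @ \<sigma> \<and> {n - m + 1..n} \<subseteq> set \<tau> \<and> \<sigma> \<in> permutations_of_set {1..a}) \<longleftrightarrow> ?S"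
    (is "?L \<longleftrightarrow> _")
  proof
    assume ?L
    then obtain \<tau> \<sigma> a where *: "a \<ge> 1" "\<pi> = \<tau> @ \<sigma>" "{n - m + 1..n} \<subseteq> set \<tau>" "set \<sigma> = {1..a}"
      by (auto simp: permutations_of_set_def)
    show ?S using split_D_all[OF assms True[unfolded *(2)] *(3,4)] *(1,2) by blast
  next
    assume ?S
    then obtain a \<rho> \<sigma> where *: "1 \<le> a" "a + m \<le> n" "\<rho> \<in> D_all (n - a) m" "\<sigma> \<in> words a []"
      "\<pi> = map (\<lambda>x. x + a) \<rho> @ \<sigma>" by blast
    have "set \<rho> = {1..n - a}" using *(2,3) assms by (simp add: D_all_iff)
    then have "set (map (\<lambda>x. x + a) \<rho>) = {a + 1..n}"
      using *(2) image_add_atLeastAtMost'[of a 1 "n - a"] by (simp add: add.commute)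
    then have "{n - m + 1..n} \<subseteq> set (map (\<lambda>x. x + a) \<rho>)" using *(2) by auto
    moreover have "\<sigma> \<in> permutations_of_set {1..a}"
      using *(4) by (auto simp: words_def permutations_of_set_def)
    ultimately show ?L using *(1,5) by blast
  qed
  then show ?thesis using True unfolding E_set_def by blast
qed (simp add: E_set_def)

text \<open>Serves to merge two successively split suffixes into one longer suffix.\<close>

lemma words_join:
  assumes "\<rho> \<in> words b []" "\<sigma> \<in> words a []"
  shows "map (\<lambda>x. x + a) \<rho> @ \<sigma> \<in> words (a + b) []"
proof -
  have \<rho>: "distinct \<rho>" "set \<rho> = {1..b}" "good \<rho>" and \<sigma>: "distinct \<sigma>" "set \<sigma> = {1..a}" "good \<sigma>"
    using assms by (auto simp: words_def)
  have im: "(\<lambda>x. x + a) ` {1..b} = {a + 1..a + b}"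
    using image_add_atLeastAtMost'[of a 1 b] by (simp add: add.commute)
  have "good (map (\<lambda>x. x + a) \<rho> @ \<sigma>)" using good_join[of \<sigma> a \<rho>] \<rho> \<sigma> by auto
  moreover have "distinct (map (\<lambda>x. x + a) \<rho> @ \<sigma>)"
    using \<rho> \<sigma> by (auto simp: distinct_map inj_on_def)
  moreover have "set (map (\<lambda>x. x + a) \<rho> @ \<sigma>) = {1..a + b}"
    using im by (auto simp: \<rho> \<sigma>)
  ultimately show ?thesis by (auto simp: words_def filter_empty_conv)
qed

text \<open>Skew sums of an indecomposable word and an arbitrary avoider of length
  \<open>a\<close>.\<close>

definition joins :: "nat \<Rightarrow> nat \<Rightarrow> nat \<Rightarrow> nat list set" where
  "joins n m a = (\<lambda>(\<rho>, \<sigma>). map (\<lambda>x. x + a) \<rho> @ \<sigma>) ` (E_set (n - a) m \<times> words a [])"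

text \<open>The decomposition is made unique by taking the suffix as long as possible.\<close>

lemma D_all_decomposition:
  assumes "1 \<le> m" "m \<le> n"
  shows "D_all n m = E_set n m \<union> (\<Union>a\<in>{1..n - m}. joins n m a)"
proof (intro equalityI subsetI)
  fix \<pi> assume D: "\<pi> \<in> D_all n m"
  let ?P = "\<lambda>a. 1 \<le> a \<and> a + m \<le> n \<and> (\<exists>\<rho> \<sigma>. \<rho> \<in> D_all (n - a) m \<and> \<sigma> \<in> words a [] \<and> \<pi> = map (\<lambda>x. x + a) \<rho> @ \<sigma>)"
  show "\<pi> \<in> E_set n m \<union> (\<Union>a\<in>{1..n - m}. joins n m a)"
  proof (cases "\<pi> \<in> E_set n m")
    case False
    then have "\<exists>a. ?P a" using D assms by (auto simp: E_set_iff)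
    moreover have "\<forall>a. ?P a \<longrightarrow> a \<le> n" by auto
    ultimately obtain a where a: "?P a" and mx: "\<forall>b. ?P b \<longrightarrow> b \<le> a"
      using GreatestI_ex_nat[of ?P n] Greatest_le_nat[of ?P _ n] by blast
    then obtain \<rho> \<sigma> where *: "\<rho> \<in> D_all (n - a) m" "\<sigma> \<in> words a []" "\<pi> = map (\<lambda>x. x + a) \<rho> @ \<sigma>" by blast
    \<comment> \<open>A suffix split off from \<open>\<rho>\<close> would form, together with
      \<open>\<sigma>\<close>, a suffix of length \<open>a + b\<close>, against the maximality of
      \<open>a\<close>.\<close>
    have "\<rho> \<in> E_set (n - a) m"
    proof (rule ccontr)
      assume "\<rho> \<notin> E_set (n - a) m"
      then obtain b \<rho>' \<sigma>' where b: "1 \<le> b" "b + m \<le> n - a" "\<rho>' \<in> D_all (n - a - b) m" "\<sigma>' \<in> words b []"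
        "\<rho> = map (\<lambda>x. x + b) \<rho>' @ \<sigma>'"
        using * a assms by (auto simp: E_set_iff)
      have "\<pi> = map (\<lambda>x. x + (a + b)) \<rho>' @ (map (\<lambda>x. x + a) \<sigma>' @ \<sigma>)"
        by (simp add: *(3) b(5) comp_def ac_simps)
      moreover have "map (\<lambda>x. x + a) \<sigma>' @ \<sigma> \<in> words (a + b) []" using b(4) *(2) by (rule words_join)
      moreover have "\<rho>' \<in> D_all (n - (a + b)) m" using b(3) by (simp add: diff_diff_left)
      moreover have "1 \<le> a + b" "a + b + m \<le> n" using a b(1,2) by auto
      ultimately have "?P (a + b)" by blast
      then have "a + b \<le> a" using mx by blast
      then show False using b(1) by simp
    qed
    then have "\<pi> \<in> joins n m a" using * by (auto simp: joins_def)
    then show ?thesis using a by auto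
  qed simp
next
  fix \<pi> assume "\<pi> \<in> E_set n m \<union> (\<Union>a\<in>{1..n - m}. joins n m a)"
  then show "\<pi> \<in> D_all n m"
  proof (elim UnE UN_E)
    fix a assume a: "a \<in> {1..n - m}" "\<pi> \<in> joins n m a"
    then obtain \<rho> \<sigma> where "\<rho> \<in> E_set (n - a) m" "\<sigma> \<in> words a []" "\<pi> = map (\<lambda>x. x + a) \<rho> @ \<sigma>"
      by (auto simp: joins_def)
    then show ?thesis using a(1) assms by (auto intro!: join_D_all simp: E_set_def)
  qed (simp add: E_set_def)
qed

lemma length_words: "\<sigma> \<in> words a [] \<Longrightarrow> length \<sigma> = a"
  using distinct_card[of \<sigma>] by (auto simp: words_def)

text \<open>If a word had both decompositions, the \<open>b - a\<close> letters between the two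
  cuts, lowered by \<open>a\<close>, would be a permutation of [b - a] that splits off from
  \<open>\<rho>\<close>, contrary to \<open>\<rho> \<in> E_set (n - a) m\<close>.\<close>

lemma joins_disjoint:
  assumes "1 \<le> m" "a < b" "b + m \<le> n"
  shows "joins n m a \<inter> joins n m b = {}"
proof (rule ccontr)
  assume "joins n m a \<inter> joins n m b \<noteq> {}"
  then obtain \<rho> \<sigma> \<rho>' \<sigma>' where \<rho>: "\<rho> \<in> E_set (n - a) m" "\<sigma> \<in> words a []"
    and \<rho>': "\<rho>' \<in> E_set (n - b) m" "\<sigma>' \<in> words b []"
    and eq: "map (\<lambda>x. x + a) \<rho> @ \<sigma> = map (\<lambda>x. x + b) \<rho>' @ \<sigma>'"
    by (auto simp: joins_def)
  have "length \<sigma> = a" "length \<sigma>' = b" using \<rho> \<rho>' length_words by auto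
  then obtain us where us: "\<sigma>' = us @ \<sigma>" "map (\<lambda>x. x + a) \<rho> = map (\<lambda>x. x + b) \<rho>' @ us"
    using eq assms(2) by (auto simp: append_eq_append_conv2)
  have "set us = {a + 1..b}"
  proof -
    have "set \<sigma>' = {1..b}" "distinct \<sigma>'" "set \<sigma> = {1..a}" using \<rho> \<rho>' by (auto simp: words_def)
    then have "set us = {1..b} - {1..a}" by (auto simp: us)
    also have "\<dots> = {a + 1..b}" by auto
    finally show ?thesis .
  qed
  define \<mu> where "\<mu> = map (\<lambda>x. x - a) us"
  have us': "us = map (\<lambda>x. x + a) \<mu>" using \<open>set us = _\<close> by (auto simp: \<mu>_def intro!: map_idI[symmetric])
  have "(\<lambda>x. x + a) ` set \<mu> = (\<lambda>x. x + a) ` {1..b - a}"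
    using \<open>set us = _\<close> assms(2) image_add_atLeastAtMost'[of a 1 "b - a"] by (simp add: us' add.commute)
  then have s\<mu>: "set \<mu> = {1..b - a}" by (subst (asm) inj_image_eq_iff) (auto simp: inj_def)
  have "map (\<lambda>x. x + a) \<rho> = map (\<lambda>x. x + a) (map (\<lambda>x. x + (b - a)) \<rho>' @ \<mu>)"
    using us(2) assms(2) by (simp add: us' comp_def)
  then have \<rho>eq: "\<rho> = map (\<lambda>x. x + (b - a)) \<rho>' @ \<mu>"
    by (subst (asm) inj_map_eq_map) (auto simp: inj_def)
  have "distinct \<mu>" using \<rho>'(2) by (auto simp: words_def us us' distinct_map)
  moreover have "good us" using \<rho>'(2) by (auto simp: words_def us intro: good_subseq)
  then have "good \<mu>" using good_join[of "[]" a \<mu>] s\<mu> by (auto simp: us')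
  ultimately have "\<mu> \<in> words (b - a) []" using s\<mu> by (auto simp: words_def filter_empty_conv)
  moreover have "\<rho>' \<in> D_all (n - a - (b - a)) m" using \<rho>'(1) assms(2) by (simp add: E_set_def)
  moreover have "1 \<le> b - a" "b - a + m \<le> n - a" using assms by auto
  ultimately have "\<rho> \<notin> E_set (n - a) m"
    using \<rho>eq assms(1) by (subst E_set_iff) (simp, simp, blast)
  then show False using \<rho>(1) by contradiction
qed

lemma finite_D_all: "1 \<le> m \<Longrightarrow> m \<le> n \<Longrightarrow> finite (D_all n m)"
  by (simp add: D_all_eq)

text \<open>The two parts meet in a descent, since the letters of the first exceed \<open>a\<close>
  and those of the second do not; this gives the extra factor q.\<close>

lemma wt_joins:
  assumes "1 \<le> m" "1 \<le> a" "a + m \<le> n"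
  shows "wt (joins n m a) = indet_q * e (n - a) m * wt (words a [])"
proof -
  have "inj_on (\<lambda>(\<rho>, \<sigma>). map (\<lambda>x. x + a) \<rho> @ \<sigma>) (E_set (n - a) m \<times> words a [])"
  proof (rule inj_onI, clarify)
    fix \<rho> \<sigma> \<rho>' \<sigma>' assume "\<sigma> \<in> words a []" "\<sigma>' \<in> words a []"
      and eq: "map (\<lambda>x. x + a) \<rho> @ \<sigma> = map (\<lambda>x. x + a) \<rho>' @ \<sigma>'"
    then have "length \<sigma> = length \<sigma>'" by (simp add: length_words)
    then have "map (\<lambda>x. x + a) \<rho> = map (\<lambda>x. x + a) \<rho>' \<and> \<sigma> = \<sigma>'" using eq by simp
    then show "\<rho> = \<rho>' \<and> \<sigma> = \<sigma>'" by (auto simp: inj_map_eq_map inj_def)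
  qed
  then have "wt (joins n m a) = (\<Sum>(\<rho>, \<sigma>)\<in>E_set (n - a) m \<times> words a []. indet_q ^ desc (map (\<lambda>x. x + a) \<rho> @ \<sigma>))"
    unfolding wt_def joins_def by (subst sum.reindex) (auto simp: case_prod_unfold)
  also have "\<dots> = (\<Sum>(\<rho>, \<sigma>)\<in>E_set (n - a) m \<times> words a []. indet_q * (indet_q ^ desc \<rho> * indet_q ^ desc \<sigma>))"
  proof (intro sum.cong refl, clarify)
    fix \<rho> \<sigma> assume *: "\<rho> \<in> E_set (n - a) m" "\<sigma> \<in> words a []"
    have s: "set \<rho> = {1..n - a}" using * assms by (auto simp: E_set_def D_all_iff)
    then have 1: "\<rho> \<noteq> []" using assms by auto
    have t: "set \<sigma> = {1..a}" using * by (simp add: words_def)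
    then have 2: "\<sigma> \<noteq> []" using assms by auto
    have "hd \<sigma> \<in> {1..a}" "last \<rho> \<in> {1..n - a}" using s t 1 2 hd_in_set last_in_set by metis+
    then have "desc (map (\<lambda>x. x + a) \<rho> @ \<sigma>) = Suc (desc \<rho> + desc \<sigma>)"
      using 1 2 by (subst desc_append) (auto simp: last_map desc_map_plus)
    then show "indet_q ^ desc (map (\<lambda>x. x + a) \<rho> @ \<sigma>) = indet_q * (indet_q ^ desc \<rho> * indet_q ^ desc \<sigma>)"
      by (simp add: power_add)
  qed
  also have "\<dots> = (\<Sum>\<rho>\<in>E_set (n - a) m. \<Sum>\<sigma>\<in>words a []. indet_q * (indet_q ^ desc \<rho> * indet_q ^ desc \<sigma>))"
    by (simp only: sum.cartesian_product)
  also have "\<dots> = indet_q * (e (n - a) m * wt (words a []))"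
    by (simp only: e_def wt_def sum_product) (simp only: sum_distrib_left)
  finally show ?thesis by (simp only: mult.assoc)
qed

text \<open>Adds up the disjoint decomposition by the suffix length \<open>a\<close>;
  \<open>dec_wt a 0\<close> is the weight of all possible suffixes.\<close>

lemma dec_wt_eq_e:
  assumes "1 \<le> m" "m \<le> n"
  shows "dec_wt (n - m) m = e n m + indet_q * (\<Sum>a=1..n-m. e (n - a) m * dec_wt a 0)"
proof -
  have fin: "finite (D_all n m)" using assms by (rule finite_D_all)
  have sub: "E_set n m \<subseteq> D_all n m" "joins n m a \<subseteq> D_all n m" if "a \<in> {1..n - m}" for a
    using D_all_decomposition[OF assms] that by auto
  have dj: "E_set n m \<inter> (\<Union>a\<in>{1..n - m}. joins n m a) = {}"
  proof -
    have "\<pi> \<notin> E_set n m" if "a \<in> {1..n - m}" "\<pi> \<in> joins n m a" for \<pi> a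
    proof -
      obtain \<rho> \<sigma> where "\<rho> \<in> E_set (n - a) m" "\<sigma> \<in> words a []" "\<pi> = map (\<lambda>x. x + a) \<rho> @ \<sigma>"
        using \<open>\<pi> \<in> joins n m a\<close> by (auto simp: joins_def)
      moreover from this have "\<rho> \<in> D_all (n - a) m" by (simp add: E_set_def)
      moreover have "1 \<le> a" "a + m \<le> n" using \<open>a \<in> {1..n - m}\<close> assms by auto
      ultimately show ?thesis unfolding E_set_iff[OF assms] by blast
    qed
    then show ?thesis by blast
  qed
  have "dec_wt (n - m) m = wt (D_all n m)" using assms by (simp add: dec_wt_def D_all_eq)
  also have "\<dots> = wt (E_set n m) + wt (\<Union>a\<in>{1..n - m}. joins n m a)"
  proof -
    have "finite (E_set n m \<union> (\<Union>a\<in>{1..n - m}. joins n m a))"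
      using fin by (simp only: D_all_decomposition[OF assms])
    then show ?thesis
      unfolding D_all_decomposition[OF assms] wt_def by (intro sum.union_disjoint dj) simp_all
  qed
  also have "wt (\<Union>a\<in>{1..n - m}. joins n m a) = (\<Sum>a=1..n-m. wt (joins n m a))"
    unfolding wt_def
  proof (rule sum.UNION_disjoint)
    show "\<forall>a\<in>{1..n - m}. finite (joins n m a)" using sub(2) fin finite_subset by blast
    show "\<forall>a\<in>{1..n - m}. \<forall>b\<in>{1..n - m}. a \<noteq> b \<longrightarrow> joins n m a \<inter> joins n m b = {}"
    proof (intro ballI impI)
      fix a b assume "a \<in> {1..n - m}" "b \<in> {1..n - m}" "a \<noteq> b"
      then consider "a < b" "b + m \<le> n" | "b < a" "a + m \<le> n" using assms by fastforce
      then show "joins n m a \<inter> joins n m b = {}"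
        using joins_disjoint assms(1) by cases blast+
    qed
  qed simp
  also have "\<dots> = (\<Sum>a=1..n-m. indet_q * (e (n - a) m * dec_wt a 0))"
    using assms by (intro sum.cong refl) (auto simp: wt_joins dec_wt_def)
  finally show ?thesis by (simp add: e_def wt_def sum_distrib_left)
qed


section \<open>Double generating functions\<close>

text \<open>The infinite sum of \<open>fps_X ^ n * P n\<close>. It exists for every
  \<open>P\<close>, since only the terms with \<open>n \<le> N\<close> reach degree
  \<open>N\<close>.\<close>

definition diag :: "(nat \<Rightarrow> 'a::comm_ring_1 fps) \<Rightarrow> 'a fps" where
  "diag P = Abs_fps (\<lambda>N. \<Sum>n\<le>N. fps_nth (P n) (N - n))"

lemma diag_unfold: "diag P = P 0 + fps_X * diag (\<lambda>n. P (Suc n))"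
proof (rule fps_ext)
  fix N show "fps_nth (diag P) N = fps_nth (P 0 + fps_X * diag (\<lambda>n. P (Suc n))) N"
    by (cases N) (simp_all add: diag_def sum.atMost_Suc_shift del: sum.atMost_Suc)
qed

lemma diag_add: "diag (\<lambda>n. P n + Q n) = diag P + diag Q"
  by (rule fps_ext) (simp add: diag_def sum.distrib)

text \<open>Induction on the degree: \<open>diag_unfold\<close> peels off \<open>P 0\<close>, and
  the factor \<open>fps_X\<close> lowers the degree for the remaining sum.\<close>

lemma diag_mult: "diag (\<lambda>n. c * P n) = c * diag P"
proof -
  have "\<forall>P. fps_nth (diag (\<lambda>n. c * P n)) N = fps_nth (c * diag P) N" for N
  proof (induction N)
    case 0
    show ?case by (simp add: diag_def)
  next
    case (Suc N)
    show ?case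
    proof
      fix P
      have "fps_nth (diag (\<lambda>n. c * P n)) (Suc N) =
          fps_nth (c * P 0 + fps_X * diag (\<lambda>n. c * P (Suc n))) (Suc N)"
        by (subst diag_unfold) simp
      also have "\<dots> = fps_nth (c * P 0) (Suc N) + fps_nth (c * diag (\<lambda>n. P (Suc n))) N"
        using Suc.IH by simp
      also have "\<dots> = fps_nth (c * P 0 + fps_X * (c * diag (\<lambda>n. P (Suc n)))) (Suc N)"
        by simp
      also have "c * P 0 + fps_X * (c * diag (\<lambda>n. P (Suc n))) = c * diag P"
        by (subst (2) diag_unfold) (simp add: algebra_simps)
      finally show "fps_nth (diag (\<lambda>n. c * P n)) (Suc N) = fps_nth (c * diag P) (Suc N)" .
    qed
  qed
  then show ?thesis by (intro fps_ext) blast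
qed

lemma diag_const: "diag (\<lambda>n. fps_const (a n)) = Abs_fps a"
proof (rule fps_ext)
  fix N
  have "(\<Sum>n\<le>N. fps_nth (fps_const (a n)) (N - n)) = (\<Sum>n\<in>{N}. a n)"
    by (rule sum.mono_neutral_cong_right) auto
  then show "fps_nth (diag (\<lambda>n. fps_const (a n))) N = fps_nth (Abs_fps a) N"
    by (simp add: diag_def)
qed

text \<open>\<open>gf a V\<close> is the double series with coefficients \<open>a b k\<close> at \<open>x\<^sup>b (xV)\<^sup>k\<close>.
  Allowing power series for \<open>V\<close> makes it possible to substitute the root of a kernel.\<close>

definition gf :: "(nat \<Rightarrow> nat \<Rightarrow> 'a::comm_ring_1) \<Rightarrow> 'a fps \<Rightarrow> 'a fps" where
  "gf a V = diag (\<lambda>n. \<Sum>k\<le>n. fps_const (a (n - k) k) * V ^ k)"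

text \<open>The value of \<open>gf a\<close> at \<open>V = 0\<close>.\<close>

definition gf0 :: "(nat \<Rightarrow> nat \<Rightarrow> 'a::comm_ring_1) \<Rightarrow> 'a fps" where
  "gf0 a = Abs_fps (\<lambda>b. a b 0)"

lemma gf_shift_snd: "gf a V = gf0 a + fps_X * V * gf (\<lambda>b k. a b (Suc k)) V"
proof -
  define Q where "Q n = (\<Sum>k\<le>n. fps_const (a (n - k) (Suc k)) * V ^ k)" for n
  define R where "R n = (if n = 0 then 0 else V * Q (n - 1))" for n
  have "(\<Sum>k\<le>n. fps_const (a (n - k) k) * V ^ k) = fps_const (a n 0) + R n" for n
    by (cases n) (simp_all add: Q_def R_def sum.atMost_Suc_shift sum_distrib_left algebra_simps del: sum.atMost_Suc)
  then have "gf a V = gf0 a + diag R"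
    by (simp add: gf_def gf0_def diag_add diag_const)
  also have "diag R = fps_X * (V * diag Q)"
    by (subst diag_unfold) (simp add: R_def diag_mult)
  finally show ?thesis by (simp add: gf_def Q_def[abs_def] mult.assoc)
qed

lemma gf_shift_fst:
  "gf a V = diag (\<lambda>n. fps_const (a 0 n) * V ^ n) + fps_X * gf (\<lambda>b k. a (Suc b) k) V"
proof -
  define Q where "Q n = (\<Sum>k\<le>n. fps_const (a (Suc (n - k)) k) * V ^ k)" for n
  define R where "R n = (if n = 0 then 0 else Q (n - 1))" for n
  have "(\<Sum>k\<le>n. fps_const (a (n - k) k) * V ^ k) = fps_const (a 0 n) * V ^ n + R n" for n
    by (cases n) (simp_all add: Q_def R_def Suc_diff_le)
  then have "gf a V = diag (\<lambda>n. fps_const (a 0 n) * V ^ n) + diag R"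
    by (simp add: gf_def diag_add)
  also have "diag R = fps_X * diag Q"
    by (subst diag_unfold) (simp add: R_def)
  finally show ?thesis by (simp add: gf_def Q_def[abs_def])
qed

lemma gf_add: "gf (\<lambda>b k. a b k + a' b k) V = gf a V + gf a' V"
  by (simp add: gf_def diag_add[symmetric] sum.distrib algebra_simps flip: fps_const_add)

lemma gf_cmult: "gf (\<lambda>b k. c * a b k) V = fps_const c * gf a V"
  by (simp add: gf_def diag_mult[symmetric] sum_distrib_left mult.assoc flip: fps_const_mult)

lemma gf_scale: "gf (\<lambda>b k. c ^ k * a b k) V = gf a (fps_const c * V)"
  by (simp add: gf_def power_mult_distrib mult_ac flip: fps_const_mult)

lemma gf0_cmult: "gf0 (\<lambda>b k. c * a b k) = fps_const c * gf0 a"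
  by (rule fps_ext) (simp add: gf0_def)

lemma fps_const_sum: "fps_const (sum h A) = (\<Sum>x\<in>A. fps_const (h x))"
  by (rule fps_ext) (simp add: fps_sum_nth)

lemma gf_const_nth: "fps_nth (gf a (fps_const u)) N = (\<Sum>k\<le>N. a (N - k) k * u ^ k)"
proof -
  have "gf a (fps_const u) = diag (\<lambda>n. fps_const (\<Sum>k\<le>n. a (n - k) k * u ^ k))"
    by (simp add: gf_def fps_const_sum)
  then show ?thesis by (simp add: diag_const)
qed

text \<open>With \<open>b = n - m\<close> and \<open>k = m - 1\<close> the length is
  \<open>b + k + 1\<close>, which is why one factor \<open>fps_X\<close> is needed in front.\<close>

lemma X_gf_const_nth:
  "fps_nth (fps_X * gf a (fps_const u)) n = (\<Sum>m=1..n. a (n - m) (m - 1) * u ^ (m - 1))"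
proof (cases n)
  case (Suc N)
  have "(\<Sum>m=1..Suc N. a (Suc N - m) (m - 1) * u ^ (m - 1)) = (\<Sum>k=0..N. a (N - k) k * u ^ k)"
    unfolding One_nat_def sum.shift_bounds_cl_Suc_ivl by simp
  then show ?thesis by (simp add: Suc gf_const_nth atMost_atLeast0)
qed simp

lemma diag_geometric:
  "(1 - fps_X * (fps_const r * V)) * diag (\<lambda>n. fps_const (c * r ^ n) * V ^ n) = fps_const c"
proof -
  let ?D = "diag (\<lambda>n. fps_const (c * r ^ n) * V ^ n)"
  have "diag (\<lambda>n. fps_const (c * r ^ Suc n) * V ^ Suc n) =
      diag (\<lambda>n. (fps_const r * V) * (fps_const (c * r ^ n) * V ^ n))"
    by (simp add: fps_const_mult[symmetric] mult_ac del: fps_const_mult)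
  then have "?D = fps_const c + fps_X * (fps_const r * V * ?D)"
    by (subst diag_unfold) (simp add: diag_mult)
  then show ?thesis by (simp add: algebra_simps)
qed

section \<open>Functional equation for the total weights\<close>

abbreviation (input) "qf \<equiv> fps_const indet_q"

text \<open>The exponent \<open>b + k + 1\<close> is the length of the words, so \<open>c\<close>
  rescales x: \<open>c = 1\<close> serves E, and \<open>c = indet_v\<close> serves D2 and
  D3.\<close>

definition dec_wt_coeff :: "ratfun \<Rightarrow> nat \<Rightarrow> nat \<Rightarrow> ratfun" where
  "dec_wt_coeff c b k = dec_wt b (Suc k) * c ^ (b + k + 1)"

definition Phi :: "ratfun \<Rightarrow> ratfun fps \<Rightarrow> ratfun fps" where
  "Phi c V = fps_X * gf (dec_wt_coeff c) V"

text \<open>The series of all nonempty avoiders by length, as a single large letter imposes no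
  condition.\<close>

definition Tot :: "ratfun \<Rightarrow> ratfun fps" where
  "Tot c = fps_X * gf0 (dec_wt_coeff c)"

text \<open>Translates \<open>dec_wt_Suc\<close>, with initial row \<open>dec_wt_0\<close>, into
  series. The second factor on the left is the kernel, quadratic in \<open>V\<close>;
  \<open>Tot c\<close> is the unknown boundary series.\<close>

lemma Phi_eq:
  fixes c :: ratfun and V :: "ratfun fps"
  defines "y \<equiv> fps_const c * fps_X"
  shows "Phi c V * (2 - V * (1 - y + 2 * qf * y) + qf * y * V\<^sup>2) =
    2 * Tot c - y * V * (1 + qf * Tot c)"
proof -
  define T where "T = gf (dec_wt_coeff c) V"
  define A where "A = gf0 (dec_wt_coeff c)"
  define Z where "Z = diag (\<lambda>n. fps_const (dec_wt_coeff c 0 n) * V ^ n)"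
  define T1 where "T1 = gf (\<lambda>b k. dec_wt_coeff c b (Suc k)) V"
  define T2 where "T2 = gf (\<lambda>b k. dec_wt_coeff c (Suc b) k) V"
  \<comment> \<open>\<open>h\<close> collects the last term of \<open>dec_wt_Suc\<close>, whose
    second index is lower by one; its boundary at \<open>k = 0\<close> is given by
    \<open>dec_wt_Suc_0\<close>.\<close>
  define h where "h b k = dec_wt (Suc b) k * c ^ (b + k + 2)" for b k
  have 1: "T = A + fps_X * V * T1" unfolding T_def A_def T1_def by (rule gf_shift_snd)
  have 2: "T = Z + fps_X * T2" unfolding T_def Z_def T2_def by (rule gf_shift_fst)
  have "dec_wt_coeff c 0 n = c * (indet_q * c) ^ n" for n
    by (simp add: dec_wt_coeff_def dec_wt_0 power_mult_distrib)
  then have 3: "(1 - fps_X * (fps_const (indet_q * c) * V)) * Z = fps_const c"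
    unfolding Z_def by (simp only: diag_geometric)
  have "(\<lambda>b. dec_wt_coeff c (Suc b)) =
      (\<lambda>b k. 2 * dec_wt_coeff c b (Suc k) + ((1 - 2 * indet_q) * c * dec_wt_coeff c b k + indet_q * h b k))"
    by (intro ext) (simp add: dec_wt_coeff_def h_def dec_wt_Suc algebra_simps)
  then have 4: "T2 = fps_const 2 * T1 + (fps_const ((1 - 2 * indet_q) * c) * T + qf * gf h V)"
    unfolding T2_def T1_def T_def by (simp only: gf_add gf_cmult)
  have "gf h V = gf0 h + fps_X * V * gf (\<lambda>b k. h b (Suc k)) V" by (rule gf_shift_snd)
  moreover have "h b (Suc k) = c * dec_wt_coeff c (Suc b) k" for b k by (simp add: h_def dec_wt_coeff_def)
  moreover have "gf0 h = gf0 (\<lambda>b k. c * dec_wt_coeff c b k)"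
    by (rule fps_ext) (simp add: gf0_def h_def dec_wt_coeff_def dec_wt_Suc_0)
  ultimately have 5: "gf h V = fps_const c * A + fps_X * V * (fps_const c * T2)"
    by (simp add: T2_def A_def gf_cmult gf0_cmult)
  define C where "C = fps_const c"
  have 3: "(1 - fps_X * (qf * C * V)) * Z = C" using 3 by (simp add: C_def)
  have 4: "T2 = 2 * T1 + ((1 - 2 * qf) * C * T + qf * gf h V)"
    using 4 by (simp add: C_def fps_numeral_fps_const fps_const_mult[symmetric] fps_const_sub[symmetric]
      del: fps_const_mult fps_const_sub)
  show ?thesis
    unfolding Phi_def Tot_def y_def T_def[symmetric] A_def[symmetric] C_def[symmetric]
    using 1 2 3 4 5[folded C_def] by algebra
qed


section \<open>Closed forms\<close>

lemma Tot_nth: "fps_nth (Tot c) n = (if n = 0 then 0 else dec_wt n 0 * c ^ n)"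
  by (cases n) (simp_all add: Tot_def gf0_def dec_wt_coeff_def dec_wt_Suc_0)

text \<open>Series form of \<open>dec_wt_eq_e\<close>: the factor is 1 for an indecomposable word
  and q \<open>Tot 1\<close> for a nonempty suffix together with the descent at the
  junction.\<close>

lemma E_gf_eq: "E_gf * (1 + qf * Tot 1) = Phi 1 (fps_const indet_v)"
proof (rule fps_ext)
  fix n
  let ?v = "indet_v"
  have "fps_nth (Phi 1 (fps_const ?v)) n = (\<Sum>m=1..n. dec_wt (n - m) m * ?v ^ (m - 1))"
    unfolding Phi_def X_gf_const_nth by (intro sum.cong) (auto simp: dec_wt_coeff_def)
  also have "\<dots> = (\<Sum>m=1..n. e n m * ?v ^ (m - 1) +
      indet_q * (\<Sum>a=1..n-m. e (n - a) m * dec_wt a 0 * ?v ^ (m - 1)))"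
    by (intro sum.cong refl) (simp add: dec_wt_eq_e distrib_right sum_distrib_right mult.assoc)
  also have "\<dots> = fps_nth E_gf n +
      indet_q * (\<Sum>m=1..n. \<Sum>a=1..n-m. e (n - a) m * dec_wt a 0 * ?v ^ (m - 1))"
    by (simp add: E_gf_def sum.distrib sum_distrib_left)
  \<comment> \<open>The range is rewritten with the symmetric condition
    \<open>a + m \<le> n\<close>, so that the summations can be exchanged.\<close>
  also have "(\<Sum>m=1..n. \<Sum>a=1..n-m. e (n - a) m * dec_wt a 0 * ?v ^ (m - 1)) =
      (\<Sum>m=1..n. \<Sum>a | a \<in> {1..n} \<and> a + m \<le> n. e (n - a) m * dec_wt a 0 * ?v ^ (m - 1))"
    by (intro sum.cong refl) auto
  also have "\<dots> = (\<Sum>a=1..n. \<Sum>m | m \<in> {1..n} \<and> a + m \<le> n. e (n - a) m * dec_wt a 0 * ?v ^ (m - 1))"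
    by (rule sum.swap_restrict) simp_all
  also have "\<dots> = (\<Sum>a=1..n. dec_wt a 0 * fps_nth E_gf (n - a))"
    unfolding E_gf_def fps_nth_Abs_fps sum_distrib_left
    by (intro sum.cong) (auto simp: algebra_simps)
  also have "\<dots> = (\<Sum>a=0..n. fps_nth (Tot 1) a * fps_nth E_gf (n - a))"
    by (rule sum.mono_neutral_cong_left) (auto simp: Tot_nth)
  also have "\<dots> = fps_nth (Tot 1 * E_gf) n"
    by (simp add: fps_mult_nth)
  finally have "fps_nth (Phi 1 (fps_const ?v)) n = fps_nth (E_gf + qf * (Tot 1 * E_gf)) n"
    by simp
  moreover have "E_gf + qf * (Tot 1 * E_gf) = E_gf * (1 + qf * Tot 1)"
    by (simp add: algebra_simps)
  ultimately show "fps_nth (E_gf * (1 + qf * Tot 1)) n = fps_nth (Phi 1 (fps_const ?v)) n"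
    by simp
qed

text \<open>The values \<open>d n n m\<close> for \<open>n = b + k + 1\<close> and
  \<open>m = k + 1\<close>, times \<open>c ^ n\<close>; at \<open>b = k = 0\<close> the convention
  for \<open>dec_wt\<close> gives the word \<open>[1]\<close> its weight 1.\<close>

definition dec_wt_pred_coeff :: "ratfun \<Rightarrow> nat \<Rightarrow> nat \<Rightarrow> ratfun" where
  "dec_wt_pred_coeff c b k = indet_q * dec_wt b k * c ^ (b + k + 1)"

lemma gf_dec_wt_pred_coeff:
  "fps_X * gf (dec_wt_pred_coeff c) V = fps_const c * fps_X * (1 + qf * Tot c + qf * V * Phi c V)"
proof -
  have "gf0 (dec_wt_pred_coeff c) = fps_const c * (1 + qf * Tot c)"
    by (rule fps_ext) (auto simp: gf0_def dec_wt_pred_coeff_def Tot_nth dec_wt_def[of 0 0])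
  moreover have "gf (\<lambda>b k. dec_wt_pred_coeff c b (Suc k)) V = gf (\<lambda>b k. (indet_q * c) * dec_wt_coeff c b k) V"
    by (simp add: dec_wt_pred_coeff_def dec_wt_coeff_def mult_ac)
  ultimately have "gf (dec_wt_pred_coeff c) V = fps_const c * (1 + qf * Tot c) + fps_X * V * (fps_const (indet_q * c) * gf (dec_wt_coeff c) V)"
    by (subst gf_shift_snd) (simp add: gf_cmult)
  then show ?thesis
    by (simp add: Phi_def algebra_simps flip: fps_const_mult)
qed

lemma D3_gf_eq:
  "D3_gf = fps_const indet_v * fps_X *
    (1 + qf * Tot indet_v + qf * fps_const indet_w * Phi indet_v (fps_const indet_w))"
proof -
  have "D3_gf = fps_X * gf (dec_wt_pred_coeff indet_v) (fps_const indet_w)"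
  proof (rule fps_ext)
    fix n
    show "fps_nth D3_gf n = fps_nth (fps_X * gf (dec_wt_pred_coeff indet_v) (fps_const indet_w)) n"
      unfolding X_gf_const_nth D3_gf_def fps_nth_Abs_fps
      by (intro sum.cong refl) (auto simp: d_top dec_wt_pred_coeff_def)
  qed
  then show ?thesis by (simp only: gf_dec_wt_pred_coeff)
qed

text \<open>There is no first letter 0, and the value 0 at \<open>b = 0\<close> lets the sum over m
  be extended to \<open>m = n\<close>.\<close>

definition D2_coeff :: "nat \<Rightarrow> nat \<Rightarrow> ratfun" where
  "D2_coeff b k = (if b = 0 then 0 else dec_hd_wt b b (Suc k) * indet_v ^ b)"

definition D1_coeff :: "nat \<Rightarrow> nat \<Rightarrow> ratfun" where
  "D1_coeff b k = (\<Sum>i=1..b-1. dec_hd_wt b i (Suc k) * indet_v ^ i)"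

lemma D2_gf_eq: "D2_gf = fps_X * gf D2_coeff (fps_const indet_w)"
proof (rule fps_ext)
  fix n
  have "(\<Sum>m=1..n-1. d n (n - m) m * indet_v ^ (n - m) * indet_w ^ (m - 1)) =
      (\<Sum>m=1..n. D2_coeff (n - m) (m - 1) * indet_w ^ (m - 1))"
    by (rule sum.mono_neutral_cong_left) (auto simp: D2_coeff_def d_small)
  then show "fps_nth D2_gf n = fps_nth (fps_X * gf D2_coeff (fps_const indet_w)) n"
    unfolding X_gf_const_nth by (simp add: D2_gf_def)
qed

lemma D1_gf_eq: "D1_gf = fps_X * gf D1_coeff (fps_const indet_w)"
proof (rule fps_ext)
  fix n
  have "(\<Sum>m=1..n-2. \<Sum>i=1..n-m-1. d n i m * indet_v ^ i * indet_w ^ (m - 1)) =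
      (\<Sum>m=1..n. D1_coeff (n - m) (m - 1) * indet_w ^ (m - 1))"
    by (rule sum.mono_neutral_cong_left) (auto simp: D1_coeff_def d_small sum_distrib_right intro!: sum.cong)
  then show "fps_nth D1_gf n = fps_nth (fps_X * gf D1_coeff (fps_const indet_w)) n"
    unfolding X_gf_const_nth by (simp add: D1_gf_def)
qed

lemma D_gf_split: "D_gf = D1_gf + D2_gf + D3_gf"
proof (rule fps_ext)
  fix n
  let ?F = "\<lambda>m i. d n i m * indet_v ^ i * indet_w ^ (m - 1)"
  have "(\<Sum>i=1..n. ?F m i) = (\<Sum>i=1..n-m-1. ?F m i) + ((if m < n then ?F m (n - m) else 0) + ?F m n)"
    if m: "m \<in> {1..n}" for m
  proof -
    have "(\<Sum>i=1..n. ?F m i) = (\<Sum>i\<in>{1..n-m} \<union> {n}. ?F m i)"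
      using m by (intro sum.mono_neutral_right) (auto simp: d_between)
    also have "\<dots> = (\<Sum>i=1..n-m. ?F m i) + ?F m n"
      using m by (subst sum.union_disjoint) auto
    also have "(\<Sum>i=1..n-m. ?F m i) = (\<Sum>i=1..n-m-1. ?F m i) + (if m < n then ?F m (n - m) else 0)"
    proof (cases "n - m")
      case (Suc b)
      then show ?thesis by auto
    qed (use m in auto)
    finally show ?thesis by (simp add: add.assoc)
  qed
  then have "fps_nth D_gf n = (\<Sum>m=1..n. \<Sum>i=1..n-m-1. ?F m i) +
      ((\<Sum>m=1..n. if m < n then ?F m (n - m) else 0) + (\<Sum>m=1..n. ?F m n))"
    by (simp add: D_gf_def sum.distrib)
  also have "(\<Sum>m=1..n. \<Sum>i=1..n-m-1. ?F m i) = fps_nth D1_gf n"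
    unfolding D1_gf_def fps_nth_Abs_fps by (rule sum.mono_neutral_right) auto
  also have "(\<Sum>m=1..n. if m < n then ?F m (n - m) else 0) = fps_nth D2_gf n"
    unfolding D2_gf_def fps_nth_Abs_fps by (rule sum.mono_neutral_cong_right) auto
  finally show "fps_nth D_gf n = fps_nth (D1_gf + D2_gf + D3_gf) n"
    by (simp add: D3_gf_def)
qed

section \<open>Functional equations for D2 and D1\<close>

lemma indet_v_nonzero [simp]: "indet_v \<noteq> 0"
  by (simp add: indet_v_def)

text \<open>In D2 the exponent of v is the first letter, whereas \<open>Phi\<close> and
  \<open>Tot\<close> carry v to the length of the word. The surplus v^k is absorbed by passing from
  \<open>V\<close> to V/v.\<close>

lemma gf_D2_coeff:
  fixes V :: "ratfun fps"
  defines "V' \<equiv> fps_const (inverse indet_v) * V"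
  shows "fps_X * gf D2_coeff V = fps_X * (qf * Phi indet_v V' + (1 - qf) *
    (fps_const indet_v * fps_X * (1 + qf * Tot indet_v + qf * V' * Phi indet_v V')))"
proof -
  have "(\<lambda>b. D2_coeff (Suc b)) = (\<lambda>b k. inverse indet_v ^ k * (indet_q * dec_wt_coeff indet_v b k + (1 - indet_q) * dec_wt_pred_coeff indet_v b k))"
  proof (intro ext)
    fix b k
    have "inverse indet_v ^ k * indet_v ^ (b + k + 1) = indet_v ^ Suc b"
      by (simp add: power_add field_simps)
    moreover have "D2_coeff (Suc b) k = indet_q * (dec_wt b (Suc k) + (1 - indet_q) * dec_wt b k) * indet_v ^ Suc b"
      by (simp add: D2_coeff_def dec_hd_wt_Suc_Suc)
    moreover have "indet_q * dec_wt_coeff indet_v b k + (1 - indet_q) * dec_wt_pred_coeff indet_v b k =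
        indet_q * (dec_wt b (Suc k) + (1 - indet_q) * dec_wt b k) * indet_v ^ (b + k + 1)"
      by (simp add: dec_wt_coeff_def dec_wt_pred_coeff_def algebra_simps)
    ultimately show "D2_coeff (Suc b) k = inverse indet_v ^ k * (indet_q * dec_wt_coeff indet_v b k + (1 - indet_q) * dec_wt_pred_coeff indet_v b k)"
      by (metis mult.left_commute)
  qed
  then have "gf (\<lambda>b. D2_coeff (Suc b)) V = qf * gf (dec_wt_coeff indet_v) V' + fps_const (1 - indet_q) * gf (dec_wt_pred_coeff indet_v) V'"
    unfolding V'_def by (simp only: gf_scale gf_add gf_cmult)
  moreover have "diag (\<lambda>n. fps_const (D2_coeff 0 n) * V ^ n) = 0"
    using diag_const[of "\<lambda>n. 0 :: ratfun"] by (simp add: D2_coeff_def) (simp add: fps_ext)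
  ultimately have "gf D2_coeff V = fps_X * (qf * gf (dec_wt_coeff indet_v) V' + fps_const (1 - indet_q) * gf (dec_wt_pred_coeff indet_v) V')"
    by (subst gf_shift_fst) simp
  moreover have "fps_const (1 - indet_q) = 1 - qf" by (simp flip: fps_const_sub)
  ultimately have "fps_X * gf D2_coeff V = fps_X * (qf * Phi indet_v V' + (1 - qf) * (fps_X * gf (dec_wt_pred_coeff indet_v) V'))"
    unfolding Phi_def by algebra
  then show ?thesis by (simp only: gf_dec_wt_pred_coeff)
qed

text \<open>The first letters counted by D1 at threshold \<open>Suc b\<close> are all small first
  letters at threshold \<open>b\<close>, so \<open>dec_hd_wt_Suc\<close> expresses D1 through D1 +
  D2 and its boundary at \<open>k = 0\<close>.\<close>

lemma gf_D1_coeff: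
  fixes V :: "ratfun fps"
  defines "D1 \<equiv> fps_X * gf D1_coeff V" and "D2 \<equiv> fps_X * gf D2_coeff V"
  shows "V * D1 = 2 * (D1 + D2 - fps_X * gf0 (\<lambda>b k. D1_coeff b k + D2_coeff b k)) + (1 - qf) * fps_X * V * (D1 + D2)"
proof -
  let ?c = "\<lambda>b k. D1_coeff b k + D2_coeff b k"
  have c: "?c b k = (\<Sum>i=1..b. dec_hd_wt b i (Suc k) * indet_v ^ i)" for b k
    by (cases b) (simp_all add: D1_coeff_def D2_coeff_def)
  have "(\<lambda>b. D1_coeff (Suc b)) = (\<lambda>b k. 2 * ?c b (Suc k) + (1 - indet_q) * ?c b k)"
  proof (intro ext)
    fix b k
    have "D1_coeff (Suc b) k = (\<Sum>i=1..b. (2 * dec_hd_wt b i (Suc (Suc k)) + (1 - indet_q) * dec_hd_wt b i (Suc k)) * indet_v ^ i)"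
      unfolding D1_coeff_def by (intro sum.cong) (auto simp: dec_hd_wt_Suc)
    also have "\<dots> = 2 * ?c b (Suc k) + (1 - indet_q) * ?c b k"
      unfolding c sum_distrib_left sum.distrib[symmetric] by (intro sum.cong refl) (simp add: algebra_simps)
    finally show "D1_coeff (Suc b) k = 2 * ?c b (Suc k) + (1 - indet_q) * ?c b k" .
  qed
  then have "gf (\<lambda>b. D1_coeff (Suc b)) V = fps_const 2 * gf (\<lambda>b k. ?c b (Suc k)) V + fps_const (1 - indet_q) * gf ?c V"
    by (simp only: gf_add gf_cmult)
  moreover have "diag (\<lambda>n. fps_const (D1_coeff 0 n) * V ^ n) = 0"
    using diag_const[of "\<lambda>n. 0 :: ratfun"] by (simp add: D1_coeff_def) (simp add: fps_ext)
  moreover have "fps_const (1 - indet_q) = 1 - qf" "fps_const (2::ratfun) = 2"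
    by (simp_all add: fps_numeral_fps_const flip: fps_const_sub)
  ultimately have 1: "gf D1_coeff V = fps_X * (2 * gf (\<lambda>b k. ?c b (Suc k)) V + (1 - qf) * gf ?c V)"
    by (subst gf_shift_fst) simp
  have 2: "gf ?c V = gf0 ?c + fps_X * V * gf (\<lambda>b k. ?c b (Suc k)) V"
    by (rule gf_shift_snd)
  have 3: "gf ?c V = gf D1_coeff V + gf D2_coeff V" by (rule gf_add)
  show ?thesis
    unfolding D1_def D2_def using 1 2 3 by algebra
qed

text \<open>The kernel of \<open>Phi_eq\<close> vanishes at \<open>V = 2 s / y\<close>.\<close>

lemma Tot_parametrization:
  fixes c :: ratfun and t :: "ratfun fps"
  defines "y \<equiv> fps_const c * fps_X"
  assumes c: "c \<noteq> 0" and t: "t = fps_sqrt ((1 - 2*qf)\<^sup>2 * y\<^sup>2 - 2*y*(1 + 2*qf) + 1)"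
  obtains s where "t = 1 - y + 2*qf*y - 4*qf*s" "y = s * (1 - y + 2*qf*y) - 2*qf*s\<^sup>2"
    "(1 - qf*s) * Tot c = s" "t\<^sup>2 = (1 - 2*qf)\<^sup>2 * y\<^sup>2 - 2*y*(1 + 2*qf) + 1" "fps_nth t 0 = 1"
proof -
  have y0: "fps_nth y 0 = 0" by (simp add: y_def)
  have "fps_nth ((1 - 2*qf)\<^sup>2 * y\<^sup>2 - 2*y*(1 + 2*qf) + 1) 0 = 1"
    by (simp add: y0 power2_eq_square)
  note sq = fps_sqrt[OF this, folded t]
  \<comment> \<open>Solves the first claimed equation for \<open>s\<close>; the equation for the
    square of \<open>t\<close> then becomes quadratic in \<open>s\<close>.\<close>
  define s where "s = fps_const (inverse (4 * indet_q)) * (1 - y + 2*qf*y - t)"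
  have "4 * qf = fps_const (4 * indet_q)"
    by (simp add: fps_numeral_fps_const)
  then have "4 * qf * s = 1 - y + 2*qf*y - t"
    by (simp add: s_def mult.assoc[symmetric])
  then have ts: "t = 1 - y + 2*qf*y - 4*qf*s" by (simp add: algebra_simps)
  have "8 * qf * (y - (s * (1 - y + 2*qf*y) - 2*qf*s\<^sup>2)) = 0"
    using sq(1) ts by algebra
  then have ys: "y = s * (1 - y + 2*qf*y) - 2*qf*s\<^sup>2" by simp
  have s0: "fps_nth s 0 = 0" by (simp add: s_def y0 sq)
  \<comment> \<open>As \<open>s\<close> has constant term 0, \<open>fps_shift 1 s\<close> is s/x and
    \<open>V\<close> is 2s/y.\<close>
  define V where "V = fps_const (2 * inverse c) * fps_shift 1 s"
  have "fps_X * fps_shift 1 s = s"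
    by (rule fps_ext) (simp add: s0)
  then have yV: "y * V = 2 * s" 
  proof -
    have "y * V = (fps_const c * fps_const (2 * inverse c)) * (fps_X * fps_shift 1 s)"
      by (simp only: y_def V_def mult_ac)
    then show ?thesis
      using c \<open>fps_X * fps_shift 1 s = s\<close> by (simp add: fps_numeral_fps_const)
  qed
  \<comment> \<open>Multiplied by \<open>y\<close>, the kernel becomes twice the quadratic equation
    for \<open>s\<close>. Once it vanishes, so does the right-hand side of \<open>Phi_eq\<close>,
    which determines \<open>Tot c\<close>.\<close>
  have "y * (2 - V * (1 - y + 2*qf*y) + qf * y * V\<^sup>2) = 0"
    using ys yV by algebra
  moreover have "y \<noteq> 0" using c by (simp add: y_def)
  ultimately have "2 - V * (1 - y + 2*qf*y) + qf * y * V\<^sup>2 = 0" by simp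
  then have "2 * Tot c - y * V * (1 + qf * Tot c) = 0"
    using Phi_eq[of c V] by (simp add: y_def)
  then have "2 * ((1 - qf*s) * Tot c - s) = 0"
    using yV by algebra
  then have "(1 - qf*s) * Tot c = s" by simp
  then show thesis using that ts ys sq by blast
qed

text \<open>\<open>al + w*be\<close> is the denominator of D2, and \<open>al*u + 2*be\<close> is
  \<open>u\<close> times its value at w = 2/u. The identity turns a quotient by their product into
  one by \<open>b1 + b2*t\<close>.\<close>

lemma D1_identity:
  fixes q w v x t :: "'a::idom"
  assumes "t^2 = (1 - 2*q)^2 * (v*x)^2 - 2*(v*x)*(1 + 2*q) + 1"
    and b1: "b1 = (2*q + 1)*(q + 1)*w*x^2 - 2*(w + 1)*q*x - 2*x + 2
               - ((6*q^3 - q^2 - 4*q + 1)*w*x^2 - (6*q^2 - 3*q - 1)*w*x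
                   + (2 - 6*q^2)*x + 6*q) * v*x
               + (2*q - 1)*(q - 1)*(q*x - 1)*((2*q - 1)*w*x - 2) * v^2*x^2"
    and b2: "b2 = (2*q - 1)*(q + 1)*w*x^2 - 2*(w + 1)*q*x - 2*x + 2
               - (q - 1)*(q*x - 1)*((2*q - 1)*w*x - 2) * v*x"
   and al: "al = 2-(4*q-2)*v*x+2*t" and be: "be = v*(2*q-1)^2*x^2 -(2*q+1)*x +(1-2*q)*x*t"
   and u: "u=1-(1-q)*x"
  shows "(b1+b2*t)*((1-q)*x*al-2*be)=x*(1+q+q*(1-q)*v*x)*(al+w*be)*(al*u+2*be)"
  using assms(1) unfolding b1 b2 al be u by algebra

text \<open>\<open>K\<close> is the kernel of \<open>Phi_eq\<close> at \<open>V = w\<close>; the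
  product of the first two factors on the left is D3 times \<open>(1 - q*s)*K\<close>.\<close>

lemma D3_identity:
  fixes q w v x t s y :: "'a::idom"
  assumes "y = s * (1 - y + 2*q*y) - 2*q*s^2" "t = 1 - y + 2*q*y - 4*q*s"
   and "K=2-w*(1-y+2*q*y)+q*y*w^2"
  shows "y*(K+q*w*(2*s-y*w))*(6 - w - 2*(2*q*w + 2*q - 1)*y + w*(2*q - 1)^2*y^2+ (w + 2 - (2*q - 1)*w*y) * t)=8*y*((1-q*s)*K)"
  using assms(1) unfolding assms(2,3) by algebra

lemma D2_identity:
  fixes q w v x t s y :: "'a::idom"
  assumes "y = s * (1 - y + 2*q*y) - 2*q*s^2" "t = 1 - y + 2*q*y - 4*q*s"
   and "K=2*v-w*(1-y+2*q*y)+q*x*w^2" and "y = v * x"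
   and al: "al = 2-(4*q-2)*v*x+2*t" and be: "be = v*(2*q-1)^2*x^2 -(2*q+1)*x +(1-2*q)*x*t"
  shows "x*(q*(2*s-x*w)*v+(1-q)*y*(K+q*w*(2*s-x*w)))*(al+w*be)=4*v*x^2*((1-q*s)*K)"
  using assms(1,4) unfolding assms(2,3) al be by algebra

section \<open>Solving the functional equations\<close>

lemma mult_eq_cancel:
  fixes m :: "'a::idom"
  assumes "m * D = N" "N * F = C * m" "m \<noteq> 0"
  shows "D * F = C"
proof -
  have "m * (D * F) = m * C"
    using assms(1,2) by (simp add: mult.assoc[symmetric] mult.commute[of m C])
  then show ?thesis using assms(3) by simp
qed

text \<open>Stated for a power series \<open>V\<close>, because the derivation of D1 uses it both at
  w and at the kernel root 2/(1 - (1 - q)x).\<close>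

lemma D2_closed_form:
  fixes V :: "ratfun fps"
  defines "x \<equiv> fps_X" and "v \<equiv> fps_const indet_v"
  assumes t: "t = fps_sqrt ((1 - 2*qf)\<^sup>2 * (v*x)\<^sup>2 - 2*(v*x)*(1 + 2*qf) + 1)"
    and nz: "2*v - V*(1 - v*x + 2*qf*(v*x)) + qf*x*V\<^sup>2 \<noteq> 0"
  shows "fps_X * gf D2_coeff V * (2 - (4*qf - 2)*v*x + 2*t + V * (v*(2*qf - 1)\<^sup>2*x\<^sup>2 - (2*qf + 1)*x + (1 - 2*qf)*x*t)) = 4*v*x\<^sup>2"
proof -
  define y where "y = v * x"
  obtain s where s: "t = 1 - y + 2*qf*y - 4*qf*s" "y = s * (1 - y + 2*qf*y) - 2*qf*s\<^sup>2"
    "(1 - qf*s) * Tot indet_v = s"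
    using Tot_parametrization[OF indet_v_nonzero t[unfolded v_def x_def]] unfolding y_def v_def x_def by metis
  define V' where "V' = fps_const (inverse indet_v) * V"
  have V: "v * V' = V" by (simp add: v_def V'_def mult.assoc[symmetric])
  \<comment> \<open>\<open>K\<close> is \<open>v\<close> times the kernel of \<open>Phi_eq\<close>
    at \<open>V'\<close>.\<close>
  define K where "K = 2*v - V*(1 - y + 2*qf*y) + qf*x*V\<^sup>2"
  define P where "P = Phi indet_v V'"
  define T where "T = Tot indet_v"
  define D where "D = fps_X * gf D2_coeff V"
  have D: "D = x * (qf * P + (1 - qf) * (y * (1 + qf * T + qf * V' * P)))"
    using gf_D2_coeff[of V] by (simp add: D_def P_def T_def V'_def x_def y_def v_def)
  have P: "P * (2 - V' * (1 - y + 2 * qf * y) + qf * y * V'\<^sup>2) = 2 * T - y * V' * (1 + qf * T)"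
    using Phi_eq[of indet_v V'] by (simp add: P_def T_def x_def y_def v_def)
  have T: "(1 - qf*s) * T = s" using s(3) by (simp add: T_def)
  have "(1 - qf*s) * (1 + qf * T) = 1 - qf*s + qf * ((1 - qf*s) * T)" by (simp add: algebra_simps)
  then have T': "(1 - qf*s) * (1 + qf * T) = 1" by (simp add: T)
  have "y = v * x" by (simp add: y_def)
  then have PK: "(1 - qf*s) * K * P = v * (2*s - x*V)"
    using P T V unfolding K_def by algebra
  have "(1 - qf*s) * K * D = x * (qf*(2*s - x*V)*v + (1 - qf)*y*(K + qf*V*(2*s - x*V)))"
    using D PK T' V by algebra
  moreover have "x*(qf*(2*s-x*V)*v+(1-qf)*y*(K+qf*V*(2*s-x*V)))
      * ((2-(4*qf-2)*v*x+2*t)+V*(v*(2*qf-1)\<^sup>2*x\<^sup>2 -(2*qf+1)*x +(1-2*qf)*x*t)) = 4*v*x\<^sup>2*((1-qf*s)*K)"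
    by (rule D2_identity[OF s(2,1) K_def y_def refl refl])
  moreover have "(1 - qf*s) * K \<noteq> 0" using T' nz by (auto simp: K_def y_def)
  ultimately have "D * ((2-(4*qf-2)*v*x+2*t)+V*(v*(2*qf-1)\<^sup>2*x\<^sup>2 -(2*qf+1)*x +(1-2*qf)*x*t)) = 4*v*x\<^sup>2"
    by (rule mult_eq_cancel)
  then show ?thesis by (simp only: D_def)
qed

text \<open>In this order, these enter the constant terms of the denominator of E, of the kernel for
  D3, of the factor \<open>w * u - 2\<close> in D1, and of the kernels for D2 at w and at
  2/u.\<close>

lemma indet_neq:
  "2 - indet_v \<noteq> 0" "2 - indet_w \<noteq> 0" "indet_w - 2 \<noteq> 0" "2 * indet_v - indet_w \<noteq> 0" "2 * indet_v - 2 \<noteq> 0"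
proof -
  have two: "(2 :: ratfun) = to_fract 2"
    by (metis one_add_one to_fract_1 to_fract_add)
  show "2 - indet_v \<noteq> 0" "2 - indet_w \<noteq> 0" "indet_w - 2 \<noteq> 0" "2 * indet_v - indet_w \<noteq> 0" "2 * indet_v - 2 \<noteq> 0"
    unfolding two indet_v_def indet_w_def to_fract_mult[symmetric] to_fract_diff[symmetric] to_fract_eq_0_iff
    by (simp_all add: numeral_poly one_pCons)
qed

lemma D3_closed_form:
  fixes x v w t :: "ratfun fps"
  assumes x: "x = fps_X" and v: "v = fps_const indet_v" and w: "w = fps_const indet_w"
    and t: "t = fps_sqrt ((1 - 2*qf)\<^sup>2 * (v*x)\<^sup>2 - 2*(v*x)*(1 + 2*qf) + 1)"
  shows "D3_gf * (6 - w - 2*v*(2*qf*w + 2*qf - 1)*x + v\<^sup>2*w*(2*qf - 1)\<^sup>2*x\<^sup>2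
           + (w + 2 - (2*qf - 1)*v*w*x) * t) = 8*v*x"
proof -
  define y where "y = v * x"
  obtain s where s: "t = 1 - y + 2*qf*y - 4*qf*s" "y = s * (1 - y + 2*qf*y) - 2*qf*s\<^sup>2"
    "(1 - qf*s) * Tot indet_v = s"
    using Tot_parametrization[OF indet_v_nonzero t[unfolded v x]] unfolding y_def v x by metis
  define K where "K = 2 - w*(1 - y + 2*qf*y) + qf*y*w\<^sup>2"
  define P where "P = Phi indet_v w"
  define T where "T = Tot indet_v"
  have D: "D3_gf = y * (1 + qf * T + qf * w * P)"
    by (simp add: D3_gf_eq P_def T_def x y_def v w)
  have P: "P * K = 2 * T - y * w * (1 + qf * T)"
    using Phi_eq[of indet_v w] by (simp add: P_def T_def K_def x y_def v)
  have T: "(1 - qf*s) * T = s" using s(3) by (simp add: T_def)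
  have "(1 - qf*s) * (1 + qf * T) = 1 - qf*s + qf * ((1 - qf*s) * T)" by (simp add: algebra_simps)
  then have T': "(1 - qf*s) * (1 + qf * T) = 1" by (simp add: T)
  have "(1 - qf*s) * K * D3_gf = y * (K + qf*w*(2*s - y*w))"
    using D P T T' by algebra
  moreover note D3_identity[OF s(2,1) K_def]
  moreover have "K \<noteq> 0"
  proof
    assume "K = 0"
    then have "fps_nth K 0 = 0" by simp
    then show False using indet_neq by (simp add: K_def y_def x w power2_eq_square)
  qed
  then have "(1 - qf*s) * K \<noteq> 0" using T' by auto
  ultimately have "D3_gf * (6 - w - 2*(2*qf*w + 2*qf - 1)*y + w*(2*qf - 1)\<^sup>2*y\<^sup>2
      + (w + 2 - (2*qf - 1)*w*y) * t) = 8*y"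
    by (rule mult_eq_cancel)
  then show ?thesis unfolding y_def by (simp add: power_mult_distrib mult_ac)
qed

text \<open>Since \<open>1 + qf * Tot 1\<close> is inverse to \<open>1 - qf*s\<close>, E is
  \<open>1 - qf*s\<close> times \<open>Phi 1 v\<close>; \<open>s\<close> is then replaced by its
  expression in \<open>t\<close>.\<close>

lemma E_closed_form:
  fixes x v t :: "ratfun fps"
  assumes x: "x = fps_X" and v: "v = fps_const indet_v"
    and t: "t = fps_sqrt ((1 - 2*qf)\<^sup>2 * x\<^sup>2 - 2*x*(1 + 2*qf) + 1)"
  shows "E_gf * (2*qf*(qf*v\<^sup>2*x - 2*qf*v*x + v*x - v + 2)) = 1 - x - 2*qf*v*x + 2*qf*x - t"
proof -
  have t': "t = fps_sqrt ((1 - 2*qf)\<^sup>2 * (fps_const 1 * fps_X)\<^sup>2 - 2*(fps_const 1 * fps_X)*(1 + 2*qf) + 1)"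
    using t by (simp add: x)
  obtain s where s: "t = 1 - x + 2*qf*x - 4*qf*s" "(1 - qf*s) * Tot 1 = s"
    using Tot_parametrization[OF one_neq_zero t'] unfolding x by (metis fps_const_1_eq_1 mult_1)
  define T where "T = Tot 1"
  define P where "P = Phi 1 v"
  have T: "(1 - qf*s) * T = s" using s(2) by (simp add: T_def)
  have "(1 - qf*s) * (1 + qf * T) = 1 - qf*s + qf * ((1 - qf*s) * T)" by (simp add: algebra_simps)
  then have T': "(1 - qf*s) * (1 + qf * T) = 1" by (simp add: T)
  have E: "E_gf * (1 + qf * T) = P" using E_gf_eq by (simp add: T_def P_def v)
  have P: "P * (2 - v*(1 - x + 2*qf*x) + qf*x*v\<^sup>2) = 2 * T - x * v * (1 + qf * T)"
    using Phi_eq[of 1 v] by (simp add: P_def T_def x)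
  have "E_gf = (1 - qf*s) * (1 + qf * T) * E_gf" by (simp add: T')
  then have "E_gf = P * (1 - qf*s)" by (metis E mult.assoc mult.commute)
  then have "E_gf * (2 - v*(1 - x + 2*qf*x) + qf*x*v\<^sup>2) = 2 * s - x * v"
    using T T' P by algebra
  then show ?thesis using s(1) by algebra
qed

text \<open>In \<open>gf_D1_coeff\<close> the series for D1 has total coefficient
  \<open>u*V - 2\<close>. The choice V = 2/u removes it and expresses the boundary series
  \<open>B\<close> by D2; the equation at w then yields D1.\<close>

lemma D1_closed_form:
  fixes x v w t b1 b2 :: "ratfun fps"
  assumes x: "x = fps_X" and v: "v = fps_const indet_v" and w: "w = fps_const indet_w"
    and t: "t = fps_sqrt ((1 - 2*qf)\<^sup>2 * (v*x)\<^sup>2 - 2*(v*x)*(1 + 2*qf) + 1)"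
    and b1: "b1 = (2*qf + 1)*(qf + 1)*w*x^2 - 2*(w + 1)*qf*x - 2*x + 2
               - ((6*qf^3 - qf^2 - 4*qf + 1)*w*x^2 - (6*qf^2 - 3*qf - 1)*w*x
                   + (2 - 6*qf^2)*x + 6*qf) * v*x
               + (2*qf - 1)*(qf - 1)*(qf*x - 1)*((2*qf - 1)*w*x - 2) * v^2*x^2"
    and b2: "b2 = (2*qf - 1)*(qf + 1)*w*x^2 - 2*(w + 1)*qf*x - 2*x + 2
               - (qf - 1)*(qf*x - 1)*((2*qf - 1)*w*x - 2) * v*x"
  shows "D1_gf * (b1 + b2 * t) = 4*v*x^3 * (1 + qf + qf*(1 - qf)*v*x)"
proof -
  define al where "al = 2 - (4*qf - 2)*v*x + 2*t"
  define be where "be = v*(2*qf - 1)\<^sup>2*x\<^sup>2 - (2*qf + 1)*x + (1 - 2*qf)*x*t"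
  define u where "u = 1 - (1 - qf)*x"
  define B where "B = fps_X * gf0 (\<lambda>b k. D1_coeff b k + D2_coeff b k)"
  define V where "V = 2 * inverse u"
  have t2: "t\<^sup>2 = (1 - 2*qf)\<^sup>2 * (v*x)\<^sup>2 - 2*(v*x)*(1 + 2*qf) + 1" and t0: "fps_nth t 0 = 1"
    using Tot_parametrization[OF indet_v_nonzero t[unfolded v x]] unfolding v x by metis+
  have u0: "fps_nth u 0 = 1" by (simp add: u_def x)
  have uV: "u * V = 2" using inverse_mult_eq_1'[of u] u0 by (simp add: V_def mult.left_commute)
  have V0: "fps_nth V 0 = 2" using u0 by (simp add: V_def)
  have D2: "fps_X * gf D2_coeff V * (al + V * be) = 4*v*x\<^sup>2"
  proof -
    have "fps_nth (2*v - V*(1 - v*x + 2*qf*(v*x)) + qf*x*V\<^sup>2) 0 \<noteq> 0"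
      using indet_neq by (simp add: v x V0 power2_eq_square)
    then have "2*v - V*(1 - v*x + 2*qf*(v*x)) + qf*x*V\<^sup>2 \<noteq> 0" by (rule fps_nonzeroI)
    then show ?thesis using D2_closed_form[of t V] t unfolding al_def be_def v x by blast
  qed
  have D2w: "D2_gf * (al + w * be) = 4*v*x\<^sup>2"
  proof -
    have "fps_nth (2*v - w*(1 - v*x + 2*qf*(v*x)) + qf*x*w\<^sup>2) 0 \<noteq> 0"
      using indet_neq by (simp add: v x w power2_eq_square)
    then have "2*v - w*(1 - v*x + 2*qf*(v*x)) + qf*x*w\<^sup>2 \<noteq> 0" by (rule fps_nonzeroI)
    then show ?thesis using D2_closed_form[of t w] t unfolding al_def be_def v x w D2_gf_eq by blast
  qed
  have "2 * (B * u - fps_X * gf D2_coeff V) = 0"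
    using gf_D1_coeff[of V] uV u_def unfolding B_def[symmetric] x by algebra
  then have B: "B * u = fps_X * gf D2_coeff V" by simp
  have "u * (B * (al * u + 2 * be)) = u * (4*v*x\<^sup>2)"
    using B D2 uV by algebra
  moreover have "u \<noteq> 0" using u0 by auto
  ultimately have B': "B * (al * u + 2 * be) = 4*v*x\<^sup>2" by simp
  have D1w: "w * D1_gf = 2 * (D1_gf + D2_gf - B) + (1 - qf) * x * w * (D1_gf + D2_gf)"
    using gf_D1_coeff[of w] by (simp add: B_def D1_gf_eq D2_gf_eq w x)
  define A where "A = (al + w * be) * (al * u + 2 * be)"
  \<comment> \<open>Eliminating D2 and \<open>B\<close> from \<open>D1w\<close> leaves
    \<open>w * u - 2\<close> as a common factor of both sides.\<close>
  have "(w * u - 2) * (D1_gf * A) = (w * u - 2) * (4*v*x\<^sup>2 * ((1 - qf)*x*al - 2*be))"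
    using D1w D2w B' u_def unfolding A_def by algebra
  moreover have "fps_nth (w * u - 2) 0 \<noteq> 0" using u0 indet_neq by (simp add: w)
  then have "w * u - 2 \<noteq> 0" by (rule fps_nonzeroI)
  ultimately have D1A: "D1_gf * A = 4*v*x\<^sup>2 * ((1 - qf)*x*al - 2*be)" by simp
  have id: "(b1 + b2*t) * ((1 - qf)*x*al - 2*be) = x*(1 + qf + qf*(1 - qf)*v*x)*A"
    using D1_identity[OF t2 b1 b2 al_def be_def u_def] by (simp add: A_def mult.assoc)
  have "A * (D1_gf * (b1 + b2*t)) = A * (4*v*x^3 * (1 + qf + qf*(1 - qf)*v*x))"
    using D1A id by algebra
  moreover have "fps_nth A 0 \<noteq> 0"
    using t0 u0 by (simp add: A_def al_def be_def x)
  then have "A \<noteq> 0" by (rule fps_nonzeroI)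
  ultimately show ?thesis by simp
qed

lemma fps_eq_divideI:
  fixes A B C :: "'a::field fps"
  assumes "A * B = C" "fps_nth B 0 \<noteq> 0"
  shows "A = C / B"
proof -
  have "B \<noteq> 0" using assms(2) by (rule fps_nonzeroI)
  then show ?thesis using assms(1) nonzero_mult_div_cancel_right[of B A] by simp
qed

theorem theorem8:
  fixes x q v w b1 b2 :: "ratfun fps"
    and t :: "ratfun fps \<Rightarrow> ratfun fps"
  assumes x: "x = fps_X"
    and q: "q = fps_const indet_q"
    and v: "v = fps_const indet_v"
    and w: "w = fps_const indet_w"
    and t: "\<And>y. t y = fps_sqrt ((1 - 2*q)^2 * y^2 - 2*y*(1 + 2*q) + 1)"
    and b1: "b1 = (2*q + 1)*(q + 1)*w*x^2 - 2*(w + 1)*q*x - 2*x + 2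
               - ((6*q^3 - q^2 - 4*q + 1)*w*x^2 - (6*q^2 - 3*q - 1)*w*x
                   + (2 - 6*q^2)*x + 6*q) * v*x
               + (2*q - 1)*(q - 1)*(q*x - 1)*((2*q - 1)*w*x - 2) * v^2*x^2"
    and b2: "b2 = (2*q - 1)*(q + 1)*w*x^2 - 2*(w + 1)*q*x - 2*x + 2
               - (q - 1)*(q*x - 1)*((2*q - 1)*w*x - 2) * v*x"
  shows "D_gf = D1_gf + D2_gf + D3_gf
    \<and> D1_gf = 4*v*x^3 * (1 + q + q*(1 - q)*v*x) / (b1 + b2 * t (v*x))
    \<and> D2_gf = 4*v*x^2 /
        (2 - (4*q*v + 2*q*w - 2*v + w)*x + v*w*(2*q - 1)^2*x^2
           + (2 + w*x - 2*q*w*x) * t (v*x))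
    \<and> D3_gf = 8*v*x /
        (6 - w - 2*v*(2*q*w + 2*q - 1)*x + v^2*w*(2*q - 1)^2*x^2
           + (w + 2 - (2*q - 1)*v*w*x) * t (v*x))
    \<and> E_gf = (1 - x - 2*q*v*x + 2*q*x - t x) /
        (2*q*(q*v^2*x - 2*q*v*x + v*x - v + 2))"
proof (intro conjI)
  have t0: "fps_nth (t (v*x)) 0 = 1"
    unfolding t by (rule fps_sqrt(2)) (simp add: x power2_eq_square)
  show "D_gf = D1_gf + D2_gf + D3_gf" by (rule D_gf_split)
  show "D1_gf = 4*v*x^3 * (1 + q + q*(1 - q)*v*x) / (b1 + b2 * t (v*x))"
  proof (rule fps_eq_divideI)
    show "D1_gf * (b1 + b2 * t (v*x)) = 4*v*x^3 * (1 + q + q*(1 - q)*v*x)"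
      using D1_closed_form[OF x v w t[unfolded q] b1[unfolded q] b2[unfolded q]] by (simp only: q)
    show "fps_nth (b1 + b2 * t (v*x)) 0 \<noteq> 0"
      using t0 by (simp add: b1 b2 x power2_eq_square)
  qed
  show "D2_gf = 4*v*x^2 / (2 - (4*q*v + 2*q*w - 2*v + w)*x + v*w*(2*q - 1)^2*x^2
           + (2 + w*x - 2*q*w*x) * t (v*x))" (is "_ = _ / ?B")
  proof (rule fps_eq_divideI)
    have "fps_nth (2*v - w*(1 - v*x + 2*qf*(v*x)) + qf*x*w\<^sup>2) 0 \<noteq> 0"
      using indet_neq by (simp add: v x w power2_eq_square)
    then have nz: "2*v - w*(1 - v*x + 2*qf*(v*x)) + qf*x*w\<^sup>2 \<noteq> 0" by (rule fps_nonzeroI)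
    have "D2_gf * (2 - (4*q - 2)*v*x + 2*t (v*x) + w * (v*(2*q - 1)\<^sup>2*x\<^sup>2 - (2*q + 1)*x + (1 - 2*q)*x*t (v*x)))
        = 4*v*x^2"
      using D2_closed_form[of "t (v*x)" w] nz t[of "v*x"] unfolding v x w q D2_gf_eq by blast
    \<comment> \<open>Collects the terms with and without \<open>t (v*x)\<close>.\<close>
    moreover have "2 - (4*q - 2)*v*x + 2*t (v*x) + w * (v*(2*q - 1)\<^sup>2*x\<^sup>2 - (2*q + 1)*x + (1 - 2*q)*x*t (v*x)) = ?B"
      by (simp add: algebra_simps)
    ultimately show "D2_gf * ?B = 4*v*x^2" by simp
    show "fps_nth ?B 0 \<noteq> 0" using t0 by (simp add: x power2_eq_square)
  qed
  show "D3_gf = 8*v*x / (6 - w - 2*v*(2*q*w + 2*q - 1)*x + v^2*w*(2*q - 1)^2*x^2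
           + (w + 2 - (2*q - 1)*v*w*x) * t (v*x))"
  proof (rule fps_eq_divideI)
    show "D3_gf * (6 - w - 2*v*(2*q*w + 2*q - 1)*x + v^2*w*(2*q - 1)^2*x^2
           + (w + 2 - (2*q - 1)*v*w*x) * t (v*x)) = 8*v*x"
      using D3_closed_form[OF x v w t[unfolded q]] by (simp only: q)
    show "fps_nth (6 - w - 2*v*(2*q*w + 2*q - 1)*x + v^2*w*(2*q - 1)^2*x^2
           + (w + 2 - (2*q - 1)*v*w*x) * t (v*x)) 0 \<noteq> 0"
      using t0 by (simp add: x w power2_eq_square)
  qed
  show "E_gf = (1 - x - 2*q*v*x + 2*q*x - t x) / (2*q*(q*v^2*x - 2*q*v*x + v*x - v + 2))"
  proof (rule fps_eq_divideI)
    show "E_gf * (2*q*(q*v^2*x - 2*q*v*x + v*x - v + 2)) = 1 - x - 2*q*v*x + 2*q*x - t x"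
      using E_closed_form[OF x v t[unfolded q]] by (simp only: q)
    \<comment> \<open>The constant term is 2q(2 - v).\<close>
    show "fps_nth (2*q*(q*v^2*x - 2*q*v*x + v*x - v + 2)) 0 \<noteq> 0"
      using indet_neq(1) by (simp add: x v q power2_eq_square)
  qed
qed

end
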